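(* For all integers $b_1, b_2, b_3 \geq 0$, setting $w = 2(b_1+b_2+b_3) + 6$, there is a rational number $q$ such that \[ \zeta(3,3 \mid b_1, b_2, b_3) - \zeta(3,(1,2) \mid b_2, b_3, b_1) + \zeta((1,2),(1,2) \mid b_3, b_1, b_2) = q\,\frac{\pi^{w}}{(w+1)!}. \] In particular, for every integer $m \geq 0$, $2\zeta(3,3,\{2\}^m) - \zeta(3,\{2\}^m,1,2)$ is a rational multiple of $\pi^{2m+6}$.
   Context: Multiple zeta values are $\zeta(s_1, \ldots, s_k) = \sum_{0 < n_1 < n_2 < \cdots < n_k} n_1^{-s_1} \cdots n_k^{-s_k}$ for positive integers $s_i$ with $s_k \geq 2$. $\{s\}^\ell$ denotes $s$ repeated $\ell$ times. For $a_1, \ldots, a_{n-1} \in \{1, 3, (1,2)\}$ and integers $b_1, \ldots, b_n \geq 0$, define $\zeta(a_1, \ldots, a_{n-1} \mid b_1, \ldots, b_n) := \zeta(\{2\}^{b_1}, a_1, \{2\}^{b_2}, a_2, \ldots, \{2\}^{b_{n-1}}, a_{n-1}, \{2\}^{b_n})$, where an entry $(1,2)$ stands for the two consecutive arguments $1, 2$. *)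

theory Defs
  imports "HOL-Analysis.Analysis"
begin

text \<open>
  Multiple zeta values in the convention \<open>0 < n\<^sub>1 < \<dots> < n\<^sub>k\<close>, where the last argument must be at
  least 2. All summands are nonnegative, so unconditional summability is the same as convergence
  of the multiple series; \<open>infsum\<close> returns 0 on divergent argument lists.
\<close>

definition mzv :: "nat list \<Rightarrow> real" where
  "mzv s = (\<Sum>\<^sub>\<infinity>n\<in>{n :: nat list. length n = length s \<and> sorted_wrt (<) n \<and> (\<forall>x\<in>set n. 0 < x)}.
              \<Prod>i<length s. 1 / real (n ! i) ^ (s ! i))"

datatype block = One | Three | OneTwo

fun block_args :: "block \<Rightarrow> nat list" where
  "block_args One = [1]"
| "block_args Three = [3]"
| "block_args OneTwo = [1, 2]"

text \<open>
  Only lists with \<open>length bs = length as + 1\<close> are meaningful; the last equation is a dummy value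
  for all other lengths.
\<close>

fun bar_args :: "block list \<Rightarrow> nat list \<Rightarrow> nat list" where
  "bar_args [] [b] = replicate b 2"
| "bar_args (a # as) (b # bs) = replicate b 2 @ block_args a @ bar_args as bs"
| "bar_args _ _ = []"

definition mzv_bar :: "block list \<Rightarrow> nat list \<Rightarrow> real" where
  "mzv_bar as bs = mzv (bar_args as bs)"

end

theory Submission
  imports Defs "HOL-Complex_Analysis.Cauchy_Integral_Formula"
begin

text \<open>
  Write \<open>F(u | v)(x) = \<Sum>a. (- x\<^sup>2)\<^sup>a \<zeta>(u, {2}\<^sup>a, v)\<close>, \<open>\<Delta>f = f(x + 1) - f(x)\<close> and
  \<open>[f] = x f(x) + (x + 1) f(x + 1)\<close>. The finite sine products
  \<open>R(x) = \<Prod>k\<in>{m<..<n}. 1 - x\<^sup>2 / k\<^sup>2\<close> satisfy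
  \<open>(x + 1 - n) (x + 1 + m) R(x + 1) = (x + n) (x - m) R(x)\<close>, which yields the contiguity relations
  \<open>\<Delta>(x\<^sup>2 F( | 3, v)) = [F( | 2, v)]\<close>, \<open>\<Delta>(x\<^sup>2 F(u, 1, 2 | )) = [F(u, 2 | )]\<close> and
  \<open>\<Delta>(x\<^sup>2 F(u, 3 | 3, v)) = [F(u, 3 | 2, v)] - [F(u, 2 | 3, v)] + \<Delta>F(u, 2 | 2, v)\<close>.
  With \<open>u = {2}\<^sup>b\<close> and \<open>v = {2}\<^sup>c\<close> they combine to the 1-periodicity of
  \<open>x\<^sup>2 (F( | 3, u, 3, v) + F(u, 3 | 3, v) - F(u, 3, v, 1, 2 | )) - F(u, 2 | 2, v)\<close>. This is an entire
  function of exponential type at most \<open>\<pi> < 2 \<pi>\<close>, so it is constant, and the theorem is the vanishing of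
  its coefficients. The same argument proves the instances of the duality theorem that are needed to
  rewrite \<open>\<zeta>((1,2),(1,2) | b\<^sub>3, b\<^sub>1, b\<^sub>2)\<close> as \<open>\<zeta>(3,3 | b\<^sub>2, b\<^sub>1, b\<^sub>3)\<close>.
\<close>

subsection \<open>Periodic power series of small exponential type\<close>

text \<open>
  Iterating this bound shows that a periodic entire function of exponential type less than 4 is
  constant; the generating series below have type \<open>\<pi>\<close>.
\<close>
lemma periodic_deriv_bound:
  fixes f g h :: "real \<Rightarrow> real"
  assumes df: "\<And>x. (f has_real_derivative g x) (at x)"
    and dg: "\<And>x. (g has_real_derivative h x) (at x)"
    and per: "\<And>x. f (x + 1) = f x"
    and bound: "\<And>x. \<bar>h x\<bar> \<le> L"
  shows "\<bar>g x\<bar> \<le> L / 4"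
proof -
  have lip: "\<bar>g u - g v\<bar> \<le> L * \<bar>u - v\<bar>" for u v
    using field_differentiable_bound[OF convex_UNIV, of g h L u v] dg bound
    by (simp add: has_field_derivative_at_within)
  \<comment> \<open>The symmetric difference about \<open>x\<close> minus its linear part. Since
    \<open>g\<close> is \<open>L\<close>-Lipschitz, \<open>|k u| <= L * u^2\<close>; at
    \<open>u = 1/2\<close> periodicity cancels the two values of \<open>f\<close>, so only
    \<open>- g x\<close> remains and the bound is \<open>L / 4\<close>.\<close>
  define k where "k u = f (x + u) - f (x - u) - 2 * u * g x" for u
  have dk: "(k has_real_derivative g (x + u) + g (x - u) - 2 * g x) (at u)" for u
    unfolding k_def
    by (auto intro!: derivative_eq_intros DERIV_chain2[OF df])
  have dk_bound: "\<bar>g (x + u) + g (x - u) - 2 * g x\<bar> \<le> 2 * L * u" if "u \<ge> 0" for u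
    using lip[of "x + u" x] lip[of "x - u" x] that by simp
  have up: "k u - L * u\<^sup>2 \<le> 0" if "u \<ge> 0" for u
  proof -
    have "k u - L * u\<^sup>2 \<le> k 0 - L * 0\<^sup>2"
    proof (rule DERIV_nonpos_imp_nonincreasing[OF that], intro exI conjI)
      fix t assume t: "0 \<le> t" "t \<le> u"
      show "((\<lambda>u. k u - L * u\<^sup>2) has_real_derivative (g (x + t) + g (x - t) - 2 * g x) - L * (2 * t)) (at t)"
        by (auto intro!: derivative_eq_intros dk)
      show "(g (x + t) + g (x - t) - 2 * g x) - L * (2 * t) \<le> 0"
        using dk_bound[OF t(1)] by simp
    qed
    then show ?thesis by (simp add: k_def)
  qed
  have lo: "k u + L * u\<^sup>2 \<ge> 0" if "u \<ge> 0" for u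
  proof -
    have "k u + L * u\<^sup>2 \<ge> k 0 + L * 0\<^sup>2"
    proof (rule DERIV_nonneg_imp_nondecreasing[OF that], intro exI conjI)
      fix t assume t: "0 \<le> t" "t \<le> u"
      show "((\<lambda>u. k u + L * u\<^sup>2) has_real_derivative (g (x + t) + g (x - t) - 2 * g x) + L * (2 * t)) (at t)"
        by (auto intro!: derivative_eq_intros dk)
      show "(g (x + t) + g (x - t) - 2 * g x) + L * (2 * t) \<ge> 0"
        using dk_bound[OF t(1)] by simp
    qed
    then show ?thesis by (simp add: k_def)
  qed
  have "k (1/2) = - g x"
    using per[of "x - 1/2"] by (simp add: k_def add.commute)
  then show ?thesis
    using up[of "1/2"] lo[of "1/2"] by (simp add: power2_eq_square)
qed

text \<open>Termwise comparison with the exponential series. The shift by \<open>j\<close> is that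
  of the \<open>j\<close>-th derivative, so one estimate serves all derivatives.\<close>

lemma exp_type_summable:
  fixes e :: "nat \<Rightarrow> real"
  assumes "\<And>k. \<bar>e k\<bar> \<le> C * r ^ k"
  shows "summable (\<lambda>k. e (k + j) / fact k * x ^ k)" 
    and "\<bar>\<Sum>k. e (k + j) / fact k * x ^ k\<bar> \<le> C * r ^ j * exp (r * \<bar>x\<bar>)"
proof -
  have s: "(\<lambda>k. C * r ^ j * ((r * \<bar>x\<bar>) ^ k / fact k)) sums (C * r ^ j * exp (r * \<bar>x\<bar>))"
    using exp_converges[of "r * \<bar>x\<bar>"] by (intro sums_mult) (simp add: scaleR_conv_of_real divide_inverse mult.commute)
  have b: "norm (e (k + j) / fact k * x ^ k) \<le> C * r ^ j * ((r * \<bar>x\<bar>) ^ k / fact k)" for k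
  proof -
    have "norm (e (k + j) / fact k * x ^ k) = \<bar>e (k + j)\<bar> * (\<bar>x\<bar> ^ k / fact k)"
      by (simp add: abs_mult power_abs)
    also have "\<dots> \<le> (C * r ^ (k + j)) * (\<bar>x\<bar> ^ k / fact k)"
      by (intro mult_right_mono assms) auto
    finally show ?thesis by (simp add: power_add power_mult_distrib mult_ac)
  qed
  show sm: "summable (\<lambda>k. e (k + j) / fact k * x ^ k)"
    by (rule summable_comparison_test'[OF sums_summable[OF s], where N = 0]) (rule b)
  have "norm (\<Sum>k. e (k + j) / fact k * x ^ k) \<le> (\<Sum>k. C * r ^ j * ((r * \<bar>x\<bar>) ^ k / fact k))"
    by (rule norm_suminf_le[OF b sums_summable[OF s]])
  then show "\<bar>\<Sum>k. e (k + j) / fact k * x ^ k\<bar> \<le> C * r ^ j * exp (r * \<bar>x\<bar>)"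
    using sums_unique[OF s] by simp
qed

text \<open>\<open>e j\<close> is the \<open>j\<close>-th derivative at 0. Every derivative is
  periodic, hence bounded by its size on the unit interval, which grows like \<open>r ^ j\<close>.
  Passing to the next derivative \<open>n\<close> times by \<open>periodic_deriv_bound\<close> gains
  \<open>4 ^ n\<close>, and \<open>(r / 4) ^ n\<close> tends to 0.\<close>

lemma periodic_exp_type_constant:
  fixes e :: "nat \<Rightarrow> real"
  assumes bound: "\<And>k. \<bar>e k\<bar> \<le> C * r ^ k" and r: "0 \<le> r" "r < 4"
    and per: "\<And>x. (\<Sum>k. e k / fact k * (x + 1) ^ k) = (\<Sum>k. e k / fact k * x ^ k)"
    and "j \<ge> 1"
  shows "e j = 0"
proof -
  define h where "h j x = (\<Sum>k. e (k + j) / fact k * x ^ k)" for j and x :: real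
  have C: "C \<ge> 0" using bound[of 0] by simp
  have dh: "(h j has_real_derivative h (Suc j) x) (at x)" for j x
  proof -
    have "((\<lambda>x. \<Sum>k. e (k + j) / fact k * x ^ k) has_field_derivative
        (\<Sum>k. diffs (\<lambda>k. e (k + j) / fact k) k * x ^ k)) (at x)"
      by (rule termdiffs_strong_converges_everywhere) (rule exp_type_summable(1)[OF bound])
    moreover have "diffs (\<lambda>k. e (k + j) / fact k) k = e (k + Suc j) / fact k" for k
      by (simp add: diffs_def field_simps del: of_nat_Suc)
    ultimately show ?thesis by (simp add: h_def[abs_def])
  qed
  have perh: "h j (x + 1) = h j x" for j x
  proof (induction j arbitrary: x)
    case 0
    show ?case using per by (simp add: h_def)
  next
    case (Suc j)
    have "(h j has_real_derivative h (Suc j) (x + 1)) (at x)"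
      using DERIV_shift[of "h j" "h (Suc j) (x + 1)" x 1] dh[of j "x + 1"] Suc by simp
    with dh[of j x] show ?case by (rule DERIV_unique[symmetric])
  qed
  have perz: "h j (x + of_int n) = h j x" for j x n
  proof (induction n rule: int_induct[where k = 0])
    case (step1 i)
    then show ?case using perh[of j "x + of_int i"] by (simp add: add.assoc)
  next
    case (step2 i)
    then show ?case using perh[of j "x + of_int i - 1"] by (simp add: algebra_simps)
  qed simp
  have hb: "\<bar>h j x\<bar> \<le> C * r ^ j * exp r" for j x
  proof -
    have "h j x = h j (frac x)"
      using perz[of j "frac x" "\<lfloor>x\<rfloor>"] by (simp add: frac_def)
    also have "\<bar>\<dots>\<bar> \<le> C * r ^ j * exp (r * \<bar>frac x\<bar>)"
      unfolding h_def by (rule exp_type_summable(2)[OF bound])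
    also have "\<dots> \<le> C * r ^ j * exp r"
      using r C frac_lt_1[of x] by (intro mult_left_mono) (auto simp: mult_left_le)
    finally show ?thesis .
  qed
  have iter: "\<bar>h (Suc i) x\<bar> \<le> C * r ^ (Suc i + n) * exp r / 4 ^ n" for i n x
  proof (induction n arbitrary: i x)
    case 0
    show ?case using hb[of "Suc i" x] by simp
  next
    case (Suc n)
    have "\<bar>h (Suc i) x\<bar> \<le> (C * r ^ (Suc (Suc i) + n) * exp r / 4 ^ n) / 4"
      by (rule periodic_deriv_bound[OF dh dh perh Suc])
    then show ?case by (simp add: field_simps)
  qed
  obtain i where i: "j = Suc i" using \<open>j \<ge> 1\<close> by (cases j) auto
  have "(\<lambda>n. C * r ^ j * exp r * (r / 4) ^ n) \<longlonglongrightarrow> C * r ^ j * exp r * 0"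
    using r by (intro tendsto_mult tendsto_const LIMSEQ_realpow_zero) auto
  moreover have "\<bar>h j 0\<bar> \<le> C * r ^ j * exp r * (r / 4) ^ n" for n
    using iter[of i 0 n] i by (simp add: power_add power_divide mult_ac)
  ultimately have "\<bar>h j 0\<bar> \<le> 0"
    by (metis (no_types, lifting) LIMSEQ_le_const mult_zero_right)
  moreover have "h j 0 = e j"
    using powser_zero[of "\<lambda>k. e (k + j) / fact k"] by (simp add: h_def)
  ultimately show ?thesis by simp
qed

text \<open>A linear factor is absorbed by a larger base: with \<open>t = (r - p) / r\<close>,
  Bernoulli gives \<open>k * t <= (1 + t) ^ k\<close>, and
  \<open>(1 + t) * p = r - (r - p)^2 / r <= r\<close>.\<close>

lemma mult_power_le_power:
  fixes p r :: real
  assumes "0 \<le> p" "p < r"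
  shows "real k * p ^ k \<le> r / (r - p) * r ^ k"
proof -
  have r: "r > 0" using assms by simp
  have "1 + real k * ((r - p) / r) \<le> (1 + (r - p) / r) ^ k"
    using assms r by (intro Bernoulli_inequality) (simp add: field_simps)
  moreover have "(1 + (r - p) / r) * p \<le> r"
  proof -
    have "r * ((1 + (r - p) / r) * p) = r * r - (r - p)\<^sup>2"
      using r by (simp add: field_simps power2_eq_square)
    also have "\<dots> \<le> r * r" by simp
    finally show ?thesis using r by simp
  qed
  ultimately have "real k * ((r - p) / r) * p ^ k \<le> (1 + (r - p) / r) ^ k * p ^ k"
    using assms by (intro mult_right_mono) auto
  also have "\<dots> = ((1 + (r - p) / r) * p) ^ k" by (simp add: power_mult_distrib)
  also have "\<dots> \<le> r ^ k"
    using \<open>_ \<le> r\<close> assms r by (intro power_mono) auto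
  finally show ?thesis
    using assms r by (simp add: field_simps)
qed

section \<open>Even power series dominated by the sine series\<close>

definition even_series :: "(nat \<Rightarrow> real) \<Rightarrow> real \<Rightarrow> real" where
  "even_series c x = (\<Sum>a. (- (x\<^sup>2)) ^ a * c a)"

text \<open>The coefficients of \<open>sin (pi * x) / (pi * x)\<close> in powers of
  \<open>- x^2\<close>. They are both the values of \<open>zeta({2}^a)\<close> and the majorant of
  all generating series below.\<close>

definition sine_coeff :: "nat \<Rightarrow> real" where
  "sine_coeff a = pi ^ (2 * a) / fact (2 * a + 1)"

lemma sine_coeff_nonneg: "0 \<le> sine_coeff a"
  by (simp add: sine_coeff_def)

lemma summable_sine_coeff: "summable (\<lambda>a. y ^ a * sine_coeff a)"
proof (rule summable_comparison_test')
  show "summable (\<lambda>a. (\<bar>y\<bar> * pi\<^sup>2) ^ a / fact a)"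
    using summable_exp[of "\<bar>y\<bar> * pi\<^sup>2"] by (simp add: divide_inverse mult.commute)
  fix a :: nat
  have "fact a \<le> (fact (2 * a + 1) :: real)" by (intro fact_mono) auto
  then have "\<bar>y\<bar> ^ a * pi ^ (2 * a) / fact (2 * a + 1) \<le> \<bar>y\<bar> ^ a * pi ^ (2 * a) / fact a"
    by (intro divide_left_mono) auto
  then show "norm (y ^ a * sine_coeff a) \<le> (\<bar>y\<bar> * pi\<^sup>2) ^ a / fact a"
    by (simp add: sine_coeff_def abs_mult power_abs power_mult_distrib power_mult)
qed

lemma summable_even_series:
  assumes "\<And>a. \<bar>c a\<bar> \<le> C * sine_coeff a"
  shows "summable (\<lambda>a. y ^ a * c a)"
proof (rule summable_comparison_test')
  show "summable (\<lambda>a. C * (\<bar>y\<bar> ^ a * sine_coeff a))"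
    by (intro summable_mult summable_sine_coeff)
  show "norm (y ^ a * c a) \<le> C * (\<bar>y\<bar> ^ a * sine_coeff a)" for a
    using mult_left_mono[OF assms[of a], of "\<bar>y\<bar> ^ a"]
    by (simp add: abs_mult power_abs mult_ac)
qed

text \<open>The periodic function \<open>t - x^2 * c\<close> has coefficient
  \<open>t (Suc a) + c a\<close> at \<open>(- x^2) ^ Suc a\<close>. Domination by the sine series
  makes it of type \<open>pi\<close>, up to a linear factor in the derivatives, so all these
  coefficients vanish.\<close>

lemma periodic_even_series:
  assumes c: "\<And>a. \<bar>c a\<bar> \<le> C * sine_coeff a" and t: "\<And>a. \<bar>t a\<bar> \<le> T * sine_coeff a"
    and per: "\<And>x. (x + 1)\<^sup>2 * even_series c (x + 1) - even_series t (x + 1) =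
      x\<^sup>2 * even_series c x - even_series t x"
  shows "c a = - t (Suc a)"
proof -
  define d where "d a = t a + (case a of 0 \<Rightarrow> 0 | Suc b \<Rightarrow> c b)" for a
  \<comment> \<open>The \<open>k\<close>-th derivative at 0 of \<open>t - x^2 * c\<close>; the odd
    ones vanish.\<close>
  define e where "e k = (if even k then (-1) ^ (k div 2) * d (k div 2) * fact k else 0)" for k
  define D where "D = C / pi\<^sup>2 + T"
  have "C \<ge> 0" "T \<ge> 0"
    using c[of 0] t[of 0] by (auto simp: sine_coeff_def)
  have d_bound: "\<bar>d a\<bar> * fact (2 * a) \<le> D * (real (2 * a + 1) * pi ^ (2 * a))" for a
  proof -
    have "\<bar>t a\<bar> * fact (2 * a) \<le> T * pi ^ (2 * a)"
    proof -
      have "\<bar>t a\<bar> * fact (2 * a) \<le> T * sine_coeff a * fact (2 * a)"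
        by (intro mult_right_mono t) auto
      also have "\<dots> = T * pi ^ (2 * a) / real (2 * a + 1)"
        by (simp add: sine_coeff_def)
      also have "\<dots> \<le> T * pi ^ (2 * a) / 1"
        using \<open>T \<ge> 0\<close> by (intro divide_left_mono) auto
      also have "\<dots> = T * pi ^ (2 * a)"
        by simp
      finally show ?thesis .
    qed
    also have "\<dots> \<le> T * (real (2 * a + 1) * pi ^ (2 * a))"
      using \<open>T \<ge> 0\<close> by (intro mult_left_mono) auto
    finally have 1: "\<bar>t a\<bar> * fact (2 * a) \<le> T * (real (2 * a + 1) * pi ^ (2 * a))" .
    show ?thesis
    proof (cases a)
      case 0
      then show ?thesis using 1 \<open>C \<ge> 0\<close> by (simp add: d_def D_def add_increasing)
    next
      case (Suc b)
      have "\<bar>c b\<bar> * fact (2 * a) \<le> C * sine_coeff b * fact (2 * a)"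
        by (intro mult_right_mono c) auto
      \<comment> \<open>Multiplication by \<open>x^2\<close> shifts the index: \<open>c b\<close> is
        controlled by \<open>fact (2 * b + 1)\<close>, one factor short of
        \<open>fact (2 * a)\<close>. This is the source of the linear factor.\<close>
      also have "\<dots> = C / pi\<^sup>2 * (real (2 * a) * pi ^ (2 * a))"
      proof -
        have "fact (2 * a) = real (2 * a) * fact (2 * b + 1)"
          using Suc by simp
        then have "sine_coeff b * fact (2 * a) = real (2 * a) * pi ^ (2 * b)"
          by (simp add: sine_coeff_def del: fact_Suc)
        moreover have "pi ^ (2 * a) = pi\<^sup>2 * pi ^ (2 * b)"
          using Suc by (simp add: power2_eq_square)
        ultimately show ?thesis by simp
      qed
      also have "\<dots> \<le> C / pi\<^sup>2 * (real (2 * a + 1) * pi ^ (2 * a))"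
        using \<open>C \<ge> 0\<close> by (intro mult_left_mono mult_right_mono) auto
      finally have 2: "\<bar>c b\<bar> * fact (2 * a) \<le> C / pi\<^sup>2 * (real (2 * a + 1) * pi ^ (2 * a))" .
      have "\<bar>d a\<bar> * fact (2 * a) \<le> \<bar>t a\<bar> * fact (2 * a) + \<bar>c b\<bar> * fact (2 * a)"
        using Suc mult_right_mono[OF abs_triangle_ineq[of "t a" "c b"], of "fact (2 * a)"]
        by (simp add: d_def distrib_right)
      also have "\<dots> \<le> D * (real (2 * a + 1) * pi ^ (2 * a))"
        using 1 2 unfolding D_def distrib_right by linarith
      finally show ?thesis .
    qed
  qed
  have "D \<ge> 0" using \<open>C \<ge> 0\<close> \<open>T \<ge> 0\<close> by (simp add: D_def)
  \<comment> \<open>Any value strictly between \<open>pi\<close> and 4 serves: above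
    \<open>pi\<close> to absorb the linear factor, below 4 for
    \<open>periodic_exp_type_constant\<close>.\<close>
  define r :: real where "r = 7 / 2"
  have r: "pi < r" "0 \<le> r" "r < 4" using pi_less_4 pi_approx by (auto simp: r_def)
  define M where "M = D * (r / (r - pi) + 1)"
  have e_bound: "\<bar>e k\<bar> \<le> M * r ^ k" for k
  proof (cases "even k")
    case True
    then obtain a where k: "k = 2 * a" by auto
    have "\<bar>e k\<bar> = \<bar>d a\<bar> * fact (2 * a)" by (simp add: e_def k abs_mult)
    also have "\<dots> \<le> D * (real k * pi ^ k + pi ^ k)"
      using d_bound[of a] by (simp add: k algebra_simps)
    also have "\<dots> \<le> D * (r / (r - pi) * r ^ k + r ^ k)"
      using r \<open>D \<ge> 0\<close> by (intro mult_left_mono add_mono mult_power_le_power power_mono) auto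
    finally show ?thesis by (simp add: M_def algebra_simps)
  next
    case False
    then show ?thesis using r \<open>D \<ge> 0\<close> by (simp add: e_def M_def)
  qed
  have series: "(\<Sum>k. e k / fact k * x ^ k) = even_series t x - x\<^sup>2 * even_series c x" for x
  proof -
    define y where "y = - (x\<^sup>2)"
    have sc: "summable (\<lambda>a. y ^ a * c a)" and st: "summable (\<lambda>a. y ^ a * t a)"
      using summable_even_series c t by blast+
    have "(\<lambda>a. y ^ Suc a * c a) sums (y * (\<Sum>a. y ^ a * c a))"
      using sums_mult[OF summable_sums[OF sc], of y] by (simp add: mult_ac)
    then have "(\<lambda>a. y ^ a * (case a of 0 \<Rightarrow> 0 | Suc b \<Rightarrow> c b)) sums (y * (\<Sum>a. y ^ a * c a))"
      using sums_Suc_iff[of "\<lambda>a. y ^ a * (case a of 0 \<Rightarrow> 0 | Suc b \<Rightarrow> c b)" "y * (\<Sum>a. y ^ a * c a)"]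
      by simp
    from sums_add[OF summable_sums[OF st] this]
    have "(\<lambda>a. y ^ a * d a) sums (even_series t x - x\<^sup>2 * even_series c x)"
      by (simp add: d_def distrib_left even_series_def y_def)
    moreover have "y ^ a * d a = e (2 * a) / fact (2 * a) * x ^ (2 * a)" for a
      by (simp add: y_def e_def power_minus[of "x\<^sup>2"] power_mult)
    ultimately have "(\<lambda>a. e (2 * a) / fact (2 * a) * x ^ (2 * a)) sums
        (even_series t x - x\<^sup>2 * even_series c x)" by simp
    then have "(\<lambda>k. e k / fact k * x ^ k) sums (even_series t x - x\<^sup>2 * even_series c x)"
      by (subst (asm) sums_mono_reindex[where f = "\<lambda>k. e k / fact k * x ^ k"])
        (auto simp: strict_mono_def e_def image_iff elim!: evenE)
    then show ?thesis by (rule sums_unique[symmetric])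
  qed
  have "e (2 * Suc a) = 0"
  proof (rule periodic_exp_type_constant[OF e_bound r(2,3)])
    show "(\<Sum>k. e k / fact k * (x + 1) ^ k) = (\<Sum>k. e k / fact k * x ^ k)" for x
      unfolding series using per[of x] by linarith
  qed simp
  then show ?thesis by (simp add: e_def d_def del: fact_Suc)
qed

subsection \<open>Truncated multiple zeta values\<close>

text \<open>All indices lie strictly between the two cutoffs. Strictness at both ends lets a sum be
  cut at any of its indices into two sums of the same kind.\<close>

fun between_sum :: "nat list \<Rightarrow> nat \<Rightarrow> nat \<Rightarrow> real" where
  "between_sum [] m N = 1"
| "between_sum (k # s) m N = (\<Sum>j\<in>{m<..<N}. 1 / real j ^ k * between_sum s j N)"

lemma between_sum_nonneg: "0 \<le> between_sum s m N"
  by (induction s arbitrary: m) (auto intro!: sum_nonneg)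

lemma between_sum_antimono: "m \<le> m' \<Longrightarrow> between_sum s m' N \<le> between_sum s m N"
  by (cases s) (auto intro!: sum_mono2 divide_nonneg_nonneg between_sum_nonneg)

lemma between_sum_mono: "N \<le> N' \<Longrightarrow> between_sum s m N \<le> between_sum s m N'"
proof (induction s arbitrary: m)
  case (Cons k s)
  have "(\<Sum>j\<in>{m<..<N}. 1 / real j ^ k * between_sum s j N) \<le> (\<Sum>j\<in>{m<..<N}. 1 / real j ^ k * between_sum s j N')"
    using Cons by (intro sum_mono mult_left_mono) auto
  also have "\<dots> \<le> (\<Sum>j\<in>{m<..<N'}. 1 / real j ^ k * between_sum s j N')"
    using Cons.prems by (intro sum_mono2) (auto intro!: divide_nonneg_nonneg between_sum_nonneg)
  finally show ?case by simp
qed simp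

text \<open>Conditioning on the index \<open>j\<close> of the argument \<open>k\<close>: the indices
  of \<open>u\<close> lie below it, those of \<open>v\<close> above. The induction step exchanges a
  triangular double sum.\<close>

lemma between_sum_split:
  "between_sum (u @ k # v) m N =
    (\<Sum>j\<in>{m<..<N}. between_sum u m j * (1 / real j ^ k) * between_sum v j N)"
proof (induction u arbitrary: m)
  case (Cons l u)
  have "between_sum ((l # u) @ k # v) m N =
      (\<Sum>i\<in>{m<..<N}. \<Sum>j\<in>{i<..<N}. 1 / real i ^ l * between_sum u i j * (1 / real j ^ k) * between_sum v j N)"
    by (simp add: Cons sum_distrib_left mult_ac)
  also have "\<dots> = (\<Sum>j\<in>{m<..<N}. \<Sum>i\<in>{m<..<j}. 1 / real i ^ l * between_sum u i j * (1 / real j ^ k) * between_sum v j N)"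
    unfolding sum.Sigma[OF finite_greaterThanLessThan ballI[OF finite_greaterThanLessThan]]
    by (rule sum.reindex_bij_witness[of _ "\<lambda>(j, i). (i, j)" "\<lambda>(i, j). (j, i)"]) auto
  also have "\<dots> = (\<Sum>j\<in>{m<..<N}. between_sum (l # u) m j * (1 / real j ^ k) * between_sum v j N)"
    by (simp add: sum_distrib_right sum_divide_distrib)
  finally show ?case .
qed simp

lemma between_sum_append_le:
  "between_sum (p @ v) m N \<le> between_sum p m N * between_sum v m N"
proof (induction p arbitrary: m)
  case (Cons k p)
  have "between_sum ((k # p) @ v) m N \<le>
      (\<Sum>j\<in>{m<..<N}. 1 / real j ^ k * (between_sum p j N * between_sum v m N))"
    unfolding append_Cons between_sum.simps
  proof (intro sum_mono mult_left_mono)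
    fix j assume "j \<in> {m<..<N}"
    have "between_sum (p @ v) j N \<le> between_sum p j N * between_sum v j N" by (rule Cons)
    also have "\<dots> \<le> between_sum p j N * between_sum v m N"
      using \<open>j \<in> _\<close> by (intro mult_left_mono between_sum_antimono between_sum_nonneg) auto
    finally show "between_sum (p @ v) j N \<le> between_sum p j N * between_sum v m N" .
  qed simp
  then show ?case by (simp add: sum_distrib_right mult.assoc)
qed simp

text \<open>An index chain for \<open>u @ p @ v\<close> splits into one for \<open>p\<close> and one
  for \<open>u @ v\<close>; the product forgets how they interleave, and all terms are
  nonnegative.\<close>

lemma between_sum_insert_le:
  "between_sum (u @ p @ v) m N \<le> between_sum p m N * between_sum (u @ v) m N"
proof (induction u arbitrary: m)
  case Nil
  show ?case by (simp add: between_sum_append_le)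
next
  case (Cons k u)
  have "between_sum ((k # u) @ p @ v) m N \<le>
      (\<Sum>j\<in>{m<..<N}. 1 / real j ^ k * (between_sum p m N * between_sum (u @ v) j N))"
    unfolding append_Cons between_sum.simps
  proof (intro sum_mono mult_left_mono)
    fix j assume "j \<in> {m<..<N}"
    have "between_sum (u @ p @ v) j N \<le> between_sum p j N * between_sum (u @ v) j N" by (rule Cons)
    also have "\<dots> \<le> between_sum p m N * between_sum (u @ v) j N"
      using \<open>j \<in> _\<close> by (intro mult_right_mono between_sum_antimono between_sum_nonneg) auto
    finally show "between_sum (u @ p @ v) j N \<le> between_sum p m N * between_sum (u @ v) j N" .
  qed simp
  then show ?case by (simp add: sum_distrib_left mult_ac)
qed

section \<open>Uniform bounds for truncated sums\<close>

definition admissible :: "nat list \<Rightarrow> bool" where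
  "admissible s \<longleftrightarrow> (\<forall>k\<in>set s. 1 \<le> k) \<and> (s = [] \<or> 2 \<le> last s)"

text \<open>
  The decay \<open>1 / sqrt m\<close> of the tails, rather than mere boundedness, survives prepending an
  argument 1.
\<close>
lemma inverse_three_halves_le:
  assumes "j \<ge> 1"
  shows "1 / (real j * sqrt (real j)) \<le> 6 * (1 / sqrt (real j) - 1 / sqrt (real j + 1))"
proof -
  define a b where "a = sqrt (real j)" and "b = sqrt (real j + 1)"
  have a: "a > 0" "a\<^sup>2 = real j" and b: "b > 0" "b\<^sup>2 = real j + 1"
    using assms by (auto simp: a_def b_def)
  have "a \<ge> 1" using assms by (simp add: a_def)
  \<comment> \<open>The constant 6 arises here: \<open>b * (a + b) <= (2 * a) * (3 * a)\<close>,
    while \<open>(b - a) * (a + b) = 1\<close>.\<close>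
  have "b \<le> 2 * a"
    by (rule power2_le_imp_le) (use a b \<open>a \<ge> 1\<close> assms in \<open>auto simp: power_mult_distrib\<close>)
  have "b * (a + b) \<le> (2 * a) * (a + 2 * a)"
    using a b \<open>b \<le> 2 * a\<close> by (intro mult_mono) auto
  then have "b * (a + b) \<le> 6 * a\<^sup>2" by (simp add: power2_eq_square)
  moreover have "(b - a) * (a + b) = 1" using a b by (simp add: algebra_simps power2_eq_square)
  ultimately have "b * (a + b) \<le> 6 * a\<^sup>2 * ((b - a) * (a + b))" by simp
  then have "b \<le> 6 * a\<^sup>2 * (b - a)"
    using a b by (simp flip: mult.assoc)
  then have "b / (a\<^sup>2 * a * b) \<le> 6 * a\<^sup>2 * (b - a) / (a\<^sup>2 * a * b)"
    using a b by (intro divide_right_mono) auto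
  moreover have "6 * a\<^sup>2 * (b - a) / (a\<^sup>2 * a * b) = 6 * (1 / a - 1 / b)"
    using a(1) b(1) by (simp add: field_simps power2_eq_square)
  ultimately have "1 / (a\<^sup>2 * a) \<le> 6 * (1 / a - 1 / b)"
    using a(1) b(1) by simp
  then show ?thesis using a by (simp add: a_def b_def)
qed

text \<open>The preceding estimate telescopes. The induction keeps the end term
  \<open>6 / sqrt N\<close>, which is dropped only afterwards.\<close>

lemma sum_three_halves_le:
  "(\<Sum>j\<in>{m<..<N}. 1 / (real j * sqrt (real j))) \<le> 6 / sqrt (real m + 1)"
proof -
  have "(\<Sum>j\<in>{m<..<N}. 1 / (real j * sqrt (real j))) \<le> 6 / sqrt (real m + 1) - 6 / sqrt (real N)"
    if "m < N"
    using that
  proof (induction N)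
    case (Suc N)
    show ?case
    proof (cases "m = N")
      case True
      then show ?thesis by (simp add: greaterThanLessThan_upt add.commute)
    next
      case False
      then have "{m<..<Suc N} = insert N {m<..<N}" "m < N" using Suc.prems by auto
      then show ?thesis
        using Suc.IH inverse_three_halves_le[of N] by (simp add: add.commute)
    qed
  qed simp
  moreover have "0 \<le> 6 / sqrt (real N)" by simp
  ultimately show ?thesis by (cases "m < N") (linarith, simp)
qed

text \<open>A last argument of at least 2 gives summands of order at most
  \<open>j powr (-3/2)\<close>. Before a nonempty rest, the rest contributes
  \<open>1 / sqrt j\<close> and the new argument at least another \<open>1 / j\<close>. Either way
  the sum over \<open>j > m\<close> is again of order \<open>1 / sqrt m\<close>.\<close>

lemma between_sum_bounded_sqrt:
  assumes "admissible s" "s \<noteq> []"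
  shows "\<exists>C\<ge>0. \<forall>m N. between_sum s m N \<le> C / sqrt (real m + 1)"
  using assms
proof (induction s)
  case (Cons k s)
  obtain C where C: "C \<ge> 0" and
    step: "\<And>j N. j \<ge> 1 \<Longrightarrow> 1 / real j ^ k * between_sum s j N \<le> C * (1 / (real j * sqrt (real j)))"
  proof (cases "s = []")
    case True
    have "1 / real j ^ k \<le> 1 / (real j * sqrt (real j))" if "j \<ge> 1" for j
    proof (rule divide_left_mono)
      have "sqrt (real j) \<le> sqrt (real j ^ 2)"
        using that self_le_power[of "real j" 2] by (subst real_sqrt_le_iff) auto
      then have "real j * sqrt (real j) \<le> real j ^ 2"
        using that by (simp add: power2_eq_square)
      also have "\<dots> \<le> real j ^ k"
        using that Cons.prems True by (intro power_increasing) (auto simp: admissible_def)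
      finally show "real j * sqrt (real j) \<le> real j ^ k" .
    qed (use that in auto)
    then show ?thesis using that[of 1] True by simp
  next
    case False
    then have "admissible s" "k \<ge> 1" using Cons.prems by (auto simp: admissible_def)
    then obtain C where C: "C \<ge> 0" "\<And>m N. between_sum s m N \<le> C / sqrt (real m + 1)"
      using Cons.IH False by blast
    have "1 / real j ^ k * between_sum s j N \<le> C * (1 / (real j * sqrt (real j)))" if "j \<ge> 1" for j N
    proof -
      have "1 / real j ^ k \<le> 1 / real j"
        using that \<open>k \<ge> 1\<close> self_le_power[of "real j" k] by (intro divide_left_mono) auto
      moreover have "between_sum s j N \<le> C / sqrt (real j)"
      proof -
        have "C / sqrt (real j + 1) \<le> C / sqrt (real j)"
          using C(1) that by (intro divide_left_mono) auto
        then show ?thesis using C(2)[of j N] by linarith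
      qed
      ultimately have "1 / real j ^ k * between_sum s j N \<le> 1 / real j * (C / sqrt (real j))"
        by (intro mult_mono between_sum_nonneg) auto
      then show ?thesis by simp
    qed
    then show ?thesis using that C(1) by blast
  qed
  have "between_sum (k # s) m N \<le> (C * 6) / sqrt (real m + 1)" for m N
  proof -
    have "between_sum (k # s) m N \<le> (\<Sum>j\<in>{m<..<N}. C * (1 / (real j * sqrt (real j))))"
      by (simp only: between_sum.simps) (intro sum_mono step, auto)
    also have "\<dots> \<le> C * (6 / sqrt (real m + 1))"
      unfolding sum_distrib_left[symmetric] by (intro mult_left_mono sum_three_halves_le C)
    finally show ?thesis by simp
  qed
  then show ?case using C by (intro exI[of _ "C * 6"]) auto
qed simp

lemma between_sum_bounded:
  assumes "admissible s"
  shows "\<exists>C. \<forall>m N. between_sum s m N \<le> C"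
proof (cases "s = []")
  case False
  then obtain C where C: "C \<ge> 0" "\<And>m N. between_sum s m N \<le> C / sqrt (real m + 1)"
    using between_sum_bounded_sqrt assms by blast
  have "C / sqrt (real m + 1) \<le> C" for m
    using divide_left_mono[of 1 "sqrt (real m + 1)" C] C(1) by simp
  then show ?thesis using C(2) order_trans by blast
qed auto

section \<open>Truncated sums as finite partial sums of the multiple series\<close>

definition chains :: "nat \<Rightarrow> nat \<Rightarrow> nat \<Rightarrow> nat list set" where
  "chains d m N = {n. length n = d \<and> sorted_wrt (<) n \<and> set n \<subseteq> {m<..<N}}"

lemma chains_Suc: "chains (Suc d) m N = (\<Union>j\<in>{m<..<N}. (#) j ` chains d j N)"
proof (intro equalityI subsetI)
  fix n assume "n \<in> chains (Suc d) m N"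
  then obtain j l where "n = j # l" "j \<in> {m<..<N}" "l \<in> chains d j N"
    by (cases n) (auto simp: chains_def subset_iff)
  then show "n \<in> (\<Union>j\<in>{m<..<N}. (#) j ` chains d j N)"
    by auto
qed (fastforce simp: chains_def)

lemma finite_chains: "finite (chains d m N)"
proof (induction d arbitrary: m)
  case 0
  have "chains 0 m N \<subseteq> {[]}" by (auto simp: chains_def)
  then show ?case by (rule finite_subset) simp
qed (simp add: chains_Suc)

lemma between_sum_eq_sum_chains:
  "between_sum s m N = (\<Sum>n\<in>chains (length s) m N. \<Prod>i<length s. 1 / real (n ! i) ^ (s ! i))"
proof (induction s arbitrary: m)
  case Nil
  have "chains 0 m N = {[]}" by (auto simp: chains_def)
  then show ?case by simp
next
  case (Cons k s)
  have "(\<Sum>n\<in>chains (length (k # s)) m N. \<Prod>i<length (k # s). 1 / real (n ! i) ^ ((k # s) ! i)) =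
      (\<Sum>j\<in>{m<..<N}. \<Sum>n\<in>(#) j ` chains (length s) j N.
        \<Prod>i<length (k # s). 1 / real (n ! i) ^ ((k # s) ! i))"
    unfolding list.size add_0_right add_Suc_right chains_Suc
    by (intro sum.UNION_disjoint) (auto simp: finite_chains)
  also have "\<dots> = (\<Sum>j\<in>{m<..<N}. 1 / real j ^ k * between_sum s j N)"
  proof (rule sum.cong[OF refl])
    fix j assume "j \<in> {m<..<N}"
    have "(\<Sum>n\<in>(#) j ` chains (length s) j N. \<Prod>i<length (k # s). 1 / real (n ! i) ^ ((k # s) ! i)) =
        (\<Sum>n\<in>chains (length s) j N. \<Prod>i<Suc (length s). 1 / real ((j # n) ! i) ^ ((k # s) ! i))"
      by (subst sum.reindex) (auto simp: inj_on_def)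
    also have "\<dots> = 1 / real j ^ k * between_sum s j N"
      by (simp only: prod.lessThan_Suc_shift Cons sum_distrib_left o_def) simp
    finally show "(\<Sum>n\<in>(#) j ` chains (length s) j N. \<Prod>i<length (k # s). 1 / real (n ! i) ^ ((k # s) ! i)) =
      1 / real j ^ k * between_sum s j N" .
  qed
  finally show ?case by simp
qed

text \<open>The chains below \<open>N\<close> exhaust the index set of \<open>mzv\<close>: a finite
  set of chains fits below its largest entry plus one. As the summands are nonnegative, the uniform
  bound gives summability, and the truncations increase to the supremum of the finite sums.\<close>

lemma between_sum_tendsto_mzv:
  assumes "admissible s"
  shows "(\<lambda>N. between_sum s 0 N) \<longlonglongrightarrow> mzv s"
    and "between_sum s 0 N \<le> mzv s"
proof -
  define A where "A = {n :: nat list. length n = length s \<and> sorted_wrt (<) n \<and> (\<forall>x\<in>set n. 0 < x)}"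
  define f where "f n = (\<Prod>i<length s. 1 / real (n ! i) ^ (s ! i))" for n :: "nat list"
  have f: "f n \<ge> 0" for n by (simp add: f_def prod_nonneg)
  have bs: "between_sum s 0 N = sum f (chains (length s) 0 N)" for N
    by (simp add: between_sum_eq_sum_chains f_def)
  have sub: "chains (length s) 0 N \<subseteq> A" for N by (auto simp: chains_def A_def)
  have cover: "\<exists>N. F \<subseteq> chains (length s) 0 N" if "finite F" "F \<subseteq> A" for F
  proof
    show "F \<subseteq> chains (length s) 0 (Suc (Max (\<Union> (set ` F))))"
      using that by (force simp: chains_def A_def less_Suc_eq_le intro!: Max_ge)
  qed
  obtain C where C: "\<And>N. between_sum s 0 N \<le> C" using between_sum_bounded[OF assms] by blast
  have le: "sum f F \<le> C" if F: "finite F" "F \<subseteq> A" for F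
  proof -
    obtain N where "F \<subseteq> chains (length s) 0 N" using cover[OF F] by blast
    then have "sum f F \<le> between_sum s 0 N"
      unfolding bs by (intro sum_mono2 finite_chains f)
    then show ?thesis using C order_trans by blast
  qed
  have summable: "f summable_on A"
    using f le by (intro nonneg_bdd_above_summable_on bdd_aboveI2[where M = C]) auto
  have mzv: "mzv s = infsum f A" by (simp add: mzv_def A_def f_def[abs_def])
  show upper: "between_sum s 0 N \<le> mzv s" for N
    unfolding bs mzv by (intro finite_sum_le_infsum summable finite_chains sub f)
  show "(\<lambda>N. between_sum s 0 N) \<longlonglongrightarrow> mzv s"
  proof (rule order_tendstoI)
    fix y assume "y < mzv s"
    obtain F where F: "finite F" "F \<subseteq> A" "y < sum f F"
      using infsum_le_finite_sums[OF summable, of y] \<open>y < mzv s\<close> unfolding mzv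
      by (meson not_le)
    obtain N where N: "F \<subseteq> chains (length s) 0 N" using cover[OF F(1,2)] by blast
    have "y < between_sum s 0 n" if "n \<ge> N" for n
    proof -
      have "sum f F \<le> between_sum s 0 N"
        unfolding bs using N by (intro sum_mono2 finite_chains f)
      also have "\<dots> \<le> between_sum s 0 n" using that by (rule between_sum_mono)
      finally show ?thesis using F by simp
    qed
    then show "\<forall>\<^sub>F n in sequentially. y < between_sum s 0 n"
      by (auto simp: eventually_sequentially)
  next
    fix y assume "mzv s < y"
    then show "\<forall>\<^sub>F n in sequentially. between_sum s 0 n < y"
      using upper by (intro always_eventually allI) (rule le_less_trans)
  qed
qed

subsection \<open>Contiguity of finite sine products\<close>

text \<open>A section of Euler's product for \<open>sin (pi * x) / (pi * x)\<close>, and the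
  generating polynomial of a block of twos whose indices lie strictly between \<open>m\<close> and
  \<open>N\<close>.\<close>

definition sine_factor :: "nat \<Rightarrow> nat \<Rightarrow> real \<Rightarrow> real" where
  "sine_factor m N x = (\<Prod>k\<in>{m<..<N}. 1 - x\<^sup>2 / (real k)\<^sup>2)"

lemma sine_factor_Suc: "m < N \<Longrightarrow> sine_factor m (Suc N) x = sine_factor m N x * (1 - x\<^sup>2 / (real N)\<^sup>2)"
proof -
  assume "m < N"
  then have "{m<..<Suc N} = insert N {m<..<N}" by auto
  then show ?thesis by (simp add: sine_factor_def)
qed

lemma sine_factor_trivial: "N \<le> Suc m \<Longrightarrow> sine_factor m N x = 1"
proof -
  assume "N \<le> Suc m"
  then have "{m<..<N} = {}" by auto
  then show ?thesis by (simp add: sine_factor_def)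
qed

text \<open>The quotient of the factors at \<open>x + 1\<close> and \<open>x\<close> is
  \<open>(k - 1 - x) * (k + 1 + x) / ((k - x) * (k + x))\<close>, which telescopes over
  \<open>k\<close>. The cross-multiplied form stays valid at zeros of the factors.\<close>

lemma sine_factor_shift:
  assumes "m < N"
  shows "(x + 1 - real N) * (x + 1 + real m) * sine_factor m N (x + 1) =
    (x + real N) * (x - real m) * sine_factor m N x"
  using assms
proof (induction N)
  case (Suc N)
  show ?case
  proof (cases "m = N")
    case True
    then show ?thesis by (simp add: sine_factor_trivial algebra_simps)
  next
    case False
    then have "m < N" using Suc.prems by simp
    define r r' where "r = sine_factor m N x" and "r' = sine_factor m N (x + 1)"
    have N: "real N \<noteq> 0" using \<open>m < N\<close> by simp
    have rearrange: "p * q * (w * (- (s * t) / d)) = - p * t / d * (s * q * w)" for p q w s t d :: real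
      by simp
    have rearrange': "- p * t / d * (q * s * w) = t * s * (w * (- (p * q) / d))" for p q w s t d :: real
      by simp
    have IH: "(x + 1 - real N) * (x + 1 + real m) * r' = (x + real N) * (x - real m) * r"
      using Suc.IH \<open>m < N\<close> by (simp add: r_def r'_def)
    have "(x + 1 - real (Suc N)) * (x + 1 + real m) * sine_factor m (Suc N) (x + 1) =
      (x - real N) * (x + 1 + real m) * (r' * (1 - (x + 1)\<^sup>2 / (real N)\<^sup>2))"
      using \<open>m < N\<close> by (simp add: sine_factor_Suc r'_def)
    also have "1 - (x + 1)\<^sup>2 / (real N)\<^sup>2 = - ((x + 1 - real N) * (x + 1 + real N)) / (real N)\<^sup>2"
      using N by (simp add: field_simps power2_eq_square)
    also have "(x - real N) * (x + 1 + real m) * (r' * (- ((x + 1 - real N) * (x + 1 + real N)) / (real N)\<^sup>2)) =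
      - (x - real N) * (x + 1 + real N) / (real N)\<^sup>2 * ((x + 1 - real N) * (x + 1 + real m) * r')"
      by (rule rearrange)
    also have "\<dots> = - (x - real N) * (x + 1 + real N) / (real N)\<^sup>2 * ((x + real N) * (x - real m) * r)"
      by (simp only: IH)
    also have "\<dots> = (x + real (Suc N)) * (x - real m) * (r * (- ((x - real N) * (x + real N)) / (real N)\<^sup>2))"
      unfolding rearrange' by (simp add: add_ac)
    also have "- ((x - real N) * (x + real N)) / (real N)\<^sup>2 = 1 - x\<^sup>2 / (real N)\<^sup>2"
      using N by (simp add: field_simps power2_eq_square)
    also have "r * (1 - x\<^sup>2 / (real N)\<^sup>2) = sine_factor m (Suc N) x"
      using \<open>m < N\<close> by (simp add: sine_factor_Suc r_def)
    finally show ?thesis .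
  qed
qed simp

text \<open>
  A rearrangement of the shift relation in which every term carries a factor that lowers an exponent
  in the weight \<open>1 / (m\<^sup>3 N\<^sup>3)\<close>.
\<close>
lemma sine_factor_contiguous:
  assumes "m < N"
  shows "(x + 1)\<^sup>2 * sine_factor m N (x + 1) - x\<^sup>2 * sine_factor m N x =
    (real N - real m) * (x * sine_factor m N x + (x + 1) * sine_factor m N (x + 1)) +
    real N * real m * (sine_factor m N (x + 1) - sine_factor m N x)"
  using sine_factor_shift[OF assms, of x] by (simp add: algebra_simps power2_eq_square)

text \<open>Expanding the product according to the smallest index \<open>j\<close> that contributes
  \<open>- x^2 / j^2\<close>; the induction peels off the factor of \<open>Suc m\<close>.\<close>

lemma sine_factor_expand:
  "sine_factor m N x = 1 - x\<^sup>2 * (\<Sum>j\<in>{m<..<N}. 1 / (real j)\<^sup>2 * sine_factor j N x)"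
proof (induction "N - m" arbitrary: m)
  case 0
  then show ?case by (simp add: sine_factor_trivial)
next
  case (Suc d)
  show ?case
  proof (cases "Suc m < N")
    case False
    then have "{m<..<N} = {}" by auto
    then show ?thesis using False by (simp add: sine_factor_trivial)
  next
    case True
    then have I: "{m<..<N} = insert (Suc m) {Suc m<..<N}" by auto
    have IH: "sine_factor (Suc m) N x = 1 - x\<^sup>2 * (\<Sum>j\<in>{Suc m<..<N}. 1 / (real j)\<^sup>2 * sine_factor j N x)"
      using Suc.hyps by (intro Suc.hyps(1)) auto
    have "sine_factor m N x = (1 - x\<^sup>2 / (real (Suc m))\<^sup>2) * sine_factor (Suc m) N x"
      unfolding sine_factor_def I by simp
    also have "\<dots> = sine_factor (Suc m) N x - x\<^sup>2 * (1 / (real (Suc m))\<^sup>2 * sine_factor (Suc m) N x)"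
      by (simp add: left_diff_distrib)
    also have "\<dots> = 1 - x\<^sup>2 * (\<Sum>j\<in>{m<..<N}. 1 / (real j)\<^sup>2 * sine_factor j N x)"
      unfolding I by (subst (1) IH) (simp add: distrib_left)
    finally show ?thesis .
  qed
qed

text \<open>The coefficients are elementary symmetric polynomials in the \<open>1 / k^2\<close>. The
  hypothesis says that at most \<open>A\<close> integers lie strictly between \<open>m\<close> and
  \<open>N\<close>, so no higher ones occur.\<close>

lemma sine_factor_series:
  assumes "N \<le> Suc (m + A)"
  shows "(\<Sum>a\<le>A. (- (x\<^sup>2)) ^ a * between_sum (replicate a 2) m N) = sine_factor m N x"
  using assms
proof (induction A arbitrary: m)
  case (Suc A)
  have "(\<Sum>a\<le>Suc A. (- (x\<^sup>2)) ^ a * between_sum (replicate a 2) m N) =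
      1 + (\<Sum>a\<le>A. (- (x\<^sup>2)) ^ Suc a * between_sum (replicate (Suc a) 2) m N)"
    by (subst sum.atMost_Suc_shift) simp
  also have "(\<Sum>a\<le>A. (- (x\<^sup>2)) ^ Suc a * between_sum (replicate (Suc a) 2) m N) =
      - (x\<^sup>2) * (\<Sum>a\<le>A. \<Sum>j\<in>{m<..<N}. 1 / (real j)\<^sup>2 * ((- (x\<^sup>2)) ^ a * between_sum (replicate a 2) j N))"
    by (simp add: sum_distrib_left mult_ac)
  also have "(\<Sum>a\<le>A. \<Sum>j\<in>{m<..<N}. 1 / (real j)\<^sup>2 * ((- (x\<^sup>2)) ^ a * between_sum (replicate a 2) j N)) =
      (\<Sum>j\<in>{m<..<N}. 1 / (real j)\<^sup>2 * (\<Sum>a\<le>A. (- (x\<^sup>2)) ^ a * between_sum (replicate a 2) j N))"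
    by (subst sum.swap) (simp add: sum_distrib_left)
  also have "\<dots> = (\<Sum>j\<in>{m<..<N}. 1 / (real j)\<^sup>2 * sine_factor j N x)"
    using Suc.prems by (intro sum.cong refl arg_cong2[where f = "(*)"] Suc.IH) auto
  finally show ?case by (subst sine_factor_expand) simp
qed (simp add: sine_factor_trivial)

section \<open>Truncated generating series\<close>

definition truncated_series :: "nat \<Rightarrow> nat list \<Rightarrow> nat list \<Rightarrow> real \<Rightarrow> real" where
  "truncated_series N u v x = (\<Sum>a\<le>N. (- (x\<^sup>2)) ^ a * between_sum (u @ replicate a 2 @ v) 0 N)"

text \<open>Splitting at the argument next to the varying block of twos resums that block to a sine
  factor. The cutoff \<open>a <= N\<close> loses nothing, because fewer than \<open>N\<close>
  positive integers lie below \<open>N\<close>.\<close>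

lemma truncated_series_head:
  "truncated_series N [] (k # v) x =
    (\<Sum>m\<in>{0<..<N}. sine_factor 0 m x * (1 / real m ^ k) * between_sum v m N)"
proof -
  have "truncated_series N [] (k # v) x =
      (\<Sum>m\<in>{0<..<N}. (\<Sum>a\<le>N. (- (x\<^sup>2)) ^ a * between_sum (replicate a 2) 0 m) *
        (1 / real m ^ k) * between_sum v m N)"
    unfolding truncated_series_def append_Nil between_sum_split sum_distrib_left sum_distrib_right
    by (subst sum.swap) (simp add: mult_ac)
  then show ?thesis by (simp add: sine_factor_series)
qed

lemma truncated_series_tail:
  "truncated_series N (u @ [k]) [] x =
    (\<Sum>n\<in>{0<..<N}. between_sum u 0 n * (1 / real n ^ k) * sine_factor n N x)"
proof -
  have "truncated_series N (u @ [k]) [] x =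
      (\<Sum>n\<in>{0<..<N}. between_sum u 0 n * (1 / real n ^ k) *
        (\<Sum>a\<le>N. (- (x\<^sup>2)) ^ a * between_sum (replicate a 2) n N))"
    unfolding truncated_series_def append_Nil2 append_assoc append_Cons append_Nil
      between_sum_split sum_distrib_left
    by (subst sum.swap) (simp add: mult_ac)
  then show ?thesis by (simp add: sine_factor_series)
qed

text \<open>The 2 of the pair \<open>1, 2\<close> joins the varying block, which thus has length at
  least 1. After multiplication by \<open>x^2\<close> only the constant term of the sine factor is
  missing.\<close>

lemma truncated_series_tail_one_two:
  "x\<^sup>2 * truncated_series N (u @ [1, 2]) [] x =
    (\<Sum>n\<in>{0<..<N}. between_sum u 0 n * (1 / real n) * (1 - sine_factor n N x))"
proof -
  have "x\<^sup>2 * truncated_series N (u @ [1, 2]) [] x =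
      x\<^sup>2 * (\<Sum>a\<le>N. (- (x\<^sup>2)) ^ a * between_sum (u @ 1 # replicate (Suc a) 2) 0 N)"
    by (simp add: truncated_series_def)
  also have "\<dots> = (\<Sum>n\<in>{0<..<N}. between_sum u 0 n * (1 / real n) *
        - (\<Sum>a\<le>N. (- (x\<^sup>2)) ^ Suc a * between_sum (replicate (Suc a) 2) n N))"
    unfolding between_sum_split sum_distrib_left sum_negf[symmetric]
    by (subst sum.swap) (simp add: mult_ac del: replicate_Suc)
  also have "\<dots> = (\<Sum>n\<in>{0<..<N}. between_sum u 0 n * (1 / real n) * (1 - sine_factor n N x))"
  proof (rule sum.cong[OF refl])
    fix n assume "n \<in> {0<..<N}"
    have "sine_factor n N x = (\<Sum>a\<le>Suc N. (- (x\<^sup>2)) ^ a * between_sum (replicate a 2) n N)"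
      by (rule sine_factor_series[symmetric]) simp
    also have "\<dots> = 1 + (\<Sum>a\<le>N. (- (x\<^sup>2)) ^ Suc a * between_sum (replicate (Suc a) 2) n N)"
      by (subst sum.atMost_Suc_shift) simp
    finally show "between_sum u 0 n * (1 / real n) *
        - (\<Sum>a\<le>N. (- (x\<^sup>2)) ^ Suc a * between_sum (replicate (Suc a) 2) n N) =
      between_sum u 0 n * (1 / real n) * (1 - sine_factor n N x)" by simp
  qed
  finally show ?thesis .
qed

lemma truncated_series_middle:
  "truncated_series N (u @ [k]) (l # v) x =
    (\<Sum>m\<in>{0<..<N}. \<Sum>n\<in>{m<..<N}. between_sum u 0 m * (1 / real m ^ k) *
      sine_factor m n x * (1 / real n ^ l) * between_sum v n N)"
proof -
  have "truncated_series N (u @ [k]) (l # v) x =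
      (\<Sum>m\<in>{0<..<N}. between_sum u 0 m * (1 / real m ^ k) *
        (\<Sum>n\<in>{m<..<N}. (\<Sum>a\<le>N. (- (x\<^sup>2)) ^ a * between_sum (replicate a 2) m n) *
          (1 / real n ^ l) * between_sum v n N))" (is "_ = ?rhs")
  proof -
    have "truncated_series N (u @ [k]) (l # v) x =
        (\<Sum>a\<le>N. \<Sum>m\<in>{0<..<N}. \<Sum>n\<in>{m<..<N}. between_sum u 0 m * (1 / real m ^ k) *
          ((- (x\<^sup>2)) ^ a * between_sum (replicate a 2) m n * (1 / real n ^ l) * between_sum v n N))"
      unfolding truncated_series_def append_assoc append_Cons append_Nil between_sum_split sum_distrib_left
      by (simp add: mult_ac)
    also have "\<dots> = (\<Sum>m\<in>{0<..<N}. \<Sum>n\<in>{m<..<N}. \<Sum>a\<le>N. between_sum u 0 m * (1 / real m ^ k) *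
          ((- (x\<^sup>2)) ^ a * between_sum (replicate a 2) m n * (1 / real n ^ l) * between_sum v n N))"
      by (subst sum.swap) (intro sum.cong refl sum.swap)
    also have "\<dots> = ?rhs" by (simp add: sum_distrib_left sum_distrib_right mult_ac)
    finally show ?thesis .
  qed
  also have "\<dots> = (\<Sum>m\<in>{0<..<N}. between_sum u 0 m * (1 / real m ^ k) *
        (\<Sum>n\<in>{m<..<N}. sine_factor m n x * (1 / real n ^ l) * between_sum v n N))"
    by (simp add: sine_factor_series)
  finally show ?thesis by (simp add: sum_distrib_left mult_ac)
qed

text \<open>\<open>sine_factor_contiguous\<close> with lower end 0: the difference term vanishes and
  the remaining factor \<open>m\<close> lowers the exponent 3 to 2.\<close>

lemma truncated_head_contiguous:
  "(x + 1)\<^sup>2 * truncated_series N [] (3 # v) (x + 1) - x\<^sup>2 * truncated_series N [] (3 # v) x =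
    x * truncated_series N [] (2 # v) x + (x + 1) * truncated_series N [] (2 # v) (x + 1)"
proof -
  have "(x + 1)\<^sup>2 * (sine_factor 0 m (x + 1) * (1 / real m ^ 3) * b) - x\<^sup>2 * (sine_factor 0 m x * (1 / real m ^ 3) * b) =
      x * (sine_factor 0 m x * (1 / real m ^ 2) * b) + (x + 1) * (sine_factor 0 m (x + 1) * (1 / real m ^ 2) * b)"
    (is "?l = ?r") if "m > 0" for m b
  proof -
    have "?l = ((x + 1)\<^sup>2 * sine_factor 0 m (x + 1) - x\<^sup>2 * sine_factor 0 m x) * (b / real m ^ 3)"
      by (simp add: algebra_simps)
    also have "\<dots> = (x * sine_factor 0 m x + (x + 1) * sine_factor 0 m (x + 1)) * (real m * (b / real m ^ 3))"
      using sine_factor_contiguous[OF that, of x] by simp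
    also have "real m * (b / real m ^ 3) = b / real m ^ 2"
      using that by (simp add: power2_eq_square power3_eq_cube)
    finally show ?thesis by (simp add: algebra_simps add_divide_distrib)
  qed
  then show ?thesis
    unfolding truncated_series_head sum_distrib_left sum_subtractf[symmetric] sum.distrib[symmetric]
    by (intro sum.cong refl) auto
qed

text \<open>In the weight \<open>1 / (m^3 * n^3)\<close>, the factor \<open>n - m\<close> lowers one
  exponent at a time, giving the two brackets with opposite signs, and \<open>n * m\<close> lowers
  both.\<close>

lemma truncated_middle_contiguous:
  fixes x :: real
  defines "y \<equiv> x + 1"
  shows "y\<^sup>2 * truncated_series N (u @ [3]) (3 # v) y - x\<^sup>2 * truncated_series N (u @ [3]) (3 # v) x =
    (x * truncated_series N (u @ [3]) (2 # v) x + y * truncated_series N (u @ [3]) (2 # v) y) -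
    (x * truncated_series N (u @ [2]) (3 # v) x + y * truncated_series N (u @ [2]) (3 # v) y) +
    (truncated_series N (u @ [2]) (2 # v) y - truncated_series N (u @ [2]) (2 # v) x)"
proof -
  have "y\<^sup>2 * (b * (1 / real m ^ 3) * sine_factor m n y * (1 / real n ^ 3) * c) -
      x\<^sup>2 * (b * (1 / real m ^ 3) * sine_factor m n x * (1 / real n ^ 3) * c) =
      (x * (b * (1 / real m ^ 3) * sine_factor m n x * (1 / real n ^ 2) * c) +
        y * (b * (1 / real m ^ 3) * sine_factor m n y * (1 / real n ^ 2) * c)) -
      (x * (b * (1 / real m ^ 2) * sine_factor m n x * (1 / real n ^ 3) * c) +
        y * (b * (1 / real m ^ 2) * sine_factor m n y * (1 / real n ^ 3) * c)) +
      (b * (1 / real m ^ 2) * sine_factor m n y * (1 / real n ^ 2) * c -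
        b * (1 / real m ^ 2) * sine_factor m n x * (1 / real n ^ 2) * c)"
    (is "?l = ?r") if "m > 0" "n > m" for m n b c
  proof -
    define r s where "r = sine_factor m n x" and "s = sine_factor m n y"
    have rs: "y\<^sup>2 * s - x\<^sup>2 * r = (real n - real m) * (x * r + y * s) + real n * real m * (s - r)"
      using sine_factor_contiguous[OF \<open>n > m\<close>, of x] by (simp add: r_def s_def y_def)
    have "?l = (y\<^sup>2 * s - x\<^sup>2 * r) * (b * c / (real m ^ 3 * real n ^ 3))"
      by (simp add: r_def s_def algebra_simps)
    also have "\<dots> = ?r"
      unfolding rs r_def[symmetric] s_def[symmetric] using that
      by (simp add: field_simps power2_eq_square power3_eq_cube)
    finally show ?thesis .
  qed
  then show ?thesis
    unfolding truncated_series_middle sum_distrib_left sum_subtractf[symmetric] sum.distrib[symmetric]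
    by (intro sum.cong refl) auto
qed

subsection \<open>Contiguity of generating series\<close>

lemma admissible_insert:
  assumes "admissible (u @ v)"
  shows "admissible (u @ replicate a 2 @ v)"
  using assms by (cases "v = []"; cases a) (auto simp: admissible_def)

definition mzv_series :: "nat list \<Rightarrow> nat list \<Rightarrow> real \<Rightarrow> real" where
  "mzv_series u v = even_series (\<lambda>a. mzv (u @ replicate a 2 @ v))"

lemma mzv_nonneg: "admissible s \<Longrightarrow> 0 \<le> mzv s"
  using between_sum_tendsto_mzv(2)[of s 0] between_sum_nonneg[of s 0 0] by linarith

lemma mzv_insert_le:
  assumes "admissible p" "admissible (u @ v)" "admissible (u @ p @ v)"
  shows "mzv (u @ p @ v) \<le> mzv p * mzv (u @ v)"
proof (rule LIMSEQ_le_const2[OF between_sum_tendsto_mzv(1)[OF assms(3)]], intro exI allI impI)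
  fix N
  have "between_sum p 0 N * between_sum (u @ v) 0 N \<le> mzv p * mzv (u @ v)"
    by (intro mult_mono between_sum_tendsto_mzv(2) between_sum_nonneg mzv_nonneg assms)
  then show "between_sum (u @ p @ v) 0 N \<le> mzv p * mzv (u @ v)"
    using between_sum_insert_le[of u p v 0 N] by linarith
qed

text \<open>Tannery's theorem, dominated by the limits because truncations increase. Summability is
  a hypothesis since the first application, to blocks of twos alone, precedes the sine
  bound.\<close>

lemma truncated_series_tendsto:
  assumes adm: "admissible (u @ v)"
    and sm: "summable (\<lambda>a. (x\<^sup>2) ^ a * mzv (u @ replicate a 2 @ v))"
  shows "(\<lambda>N. truncated_series N u v x) \<longlonglongrightarrow> mzv_series u v x"
proof -
  define f where "f a N = (if a \<le> N then (- (x\<^sup>2)) ^ a * between_sum (u @ replicate a 2 @ v) 0 N else 0)" for a N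
  note adm' = admissible_insert[OF adm]
  have "(\<lambda>N. \<Sum>a. f a N) \<longlonglongrightarrow> (\<Sum>a. (- (x\<^sup>2)) ^ a * mzv (u @ replicate a 2 @ v))"
  proof (rule tannerys_theorem[THEN conjunct2, THEN conjunct2])
    show "(f a \<longlongrightarrow> (- (x\<^sup>2)) ^ a * mzv (u @ replicate a 2 @ v)) sequentially" for a
    proof (rule Lim_transform_eventually)
      show "(\<lambda>N. (- (x\<^sup>2)) ^ a * between_sum (u @ replicate a 2 @ v) 0 N) \<longlonglongrightarrow>
          (- (x\<^sup>2)) ^ a * mzv (u @ replicate a 2 @ v)"
        by (intro tendsto_mult tendsto_const between_sum_tendsto_mzv adm')
      show "\<forall>\<^sub>F N in sequentially. (- (x\<^sup>2)) ^ a * between_sum (u @ replicate a 2 @ v) 0 N = f a N"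
        using eventually_ge_at_top[of a] by eventually_elim (simp add: f_def)
    qed
    have "norm (f a N) \<le> (x\<^sup>2) ^ a * mzv (u @ replicate a 2 @ v)" for a N
    proof -
      have "norm (f a N) \<le> (x\<^sup>2) ^ a * between_sum (u @ replicate a 2 @ v) 0 N"
        by (auto simp: f_def abs_mult power_abs between_sum_nonneg)
      also have "\<dots> \<le> (x\<^sup>2) ^ a * mzv (u @ replicate a 2 @ v)"
        by (intro mult_left_mono between_sum_tendsto_mzv adm') auto
      finally show ?thesis .
    qed
    then show "\<forall>\<^sub>F (a, N) in sequentially \<times>\<^sub>F sequentially. norm (f a N) \<le> (x\<^sup>2) ^ a * mzv (u @ replicate a 2 @ v)"
      by (intro always_eventually) auto
  qed (use sm in auto)
  moreover have "(\<Sum>a. f a N) = truncated_series N u v x" for N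
    by (subst suminf_finite[of "{..N}"]) (auto simp: f_def truncated_series_def)
  ultimately show ?thesis by (simp add: mzv_series_def even_series_def)
qed

section \<open>The values at blocks of twos and the resulting sine bound\<close>

lemma admissible_twos: "admissible (replicate a 2)"
  by (cases "a = 0") (auto simp: admissible_def)

lemma mzv_Nil: "mzv [] = 1"
proof -
  have "(\<lambda>N. 1) \<longlonglongrightarrow> mzv []"
    using between_sum_tendsto_mzv(1)[of "[]"] by (simp add: admissible_def)
  then show ?thesis by (simp add: LIMSEQ_const_iff)
qed

text \<open>The truncated generating series are the partial products of Euler's sine product, so
  both coefficient sequences define the same function near 0. The crude bound
  \<open>zeta(2) ^ a\<close> supplies a positive radius of convergence, and isolation of zeros gives
  equality of coefficients.\<close>

lemma mzv_twos: "mzv (replicate a 2) = sine_coeff a"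
proof -
  define z where "z = mzv [2]"
  have z: "z \<ge> 0" using mzv_nonneg[of "[2]"] by (simp add: z_def admissible_def)
  have mzv_le: "mzv (replicate a 2) \<le> z ^ a" for a
  proof (induction a)
    case 0
    show ?case by (simp add: mzv_Nil)
  next
    case (Suc a)
    have "mzv ([2] @ replicate a 2) \<le> z * mzv (replicate a 2)"
      using mzv_insert_le[of "[2]" "[]" "replicate a 2"] admissible_twos[of "Suc a"] admissible_twos
      by (simp add: z_def admissible_def)
    also have "\<dots> \<le> z * z ^ a" using Suc z by (intro mult_left_mono)
    finally show ?case by simp
  qed
  define r where "r = 1 / (1 + z)"
  have r: "r > 0" "r * z < 1" using z by (auto simp: r_def)
  have summable: "summable (\<lambda>a. y ^ a * mzv (replicate a 2))" if "\<bar>y\<bar> < r" for y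
  proof (rule summable_comparison_test')
    have "\<bar>y\<bar> * z \<le> r * z" using that z by (intro mult_right_mono) auto
    then show "summable (\<lambda>a. (\<bar>y\<bar> * z) ^ a)" using r z by (intro summable_geometric) auto
    show "norm (y ^ a * mzv (replicate a 2)) \<le> (\<bar>y\<bar> * z) ^ a" for a
      using mzv_le[of a] mzv_nonneg[OF admissible_twos, of a]
      by (simp add: abs_mult power_abs power_mult_distrib mult_left_mono)
  qed
  define c where "c a = mzv (replicate a 2) - sine_coeff a" for a
  have zero: "even_series c x = 0" if x: "x \<noteq> 0" "x\<^sup>2 < r" for x
  proof -
    \<comment> \<open>The cutoff \<open>Suc N\<close> is exclusive, so the factors are exactly those
      for \<open>1..N\<close> in the product formula.\<close>
    have "(\<lambda>N. truncated_series (Suc N) [] [] x) \<longlonglongrightarrow> mzv_series [] [] x"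
      using x summable[of "x\<^sup>2"] by (intro LIMSEQ_Suc truncated_series_tendsto) (auto simp: admissible_def)
    moreover have "truncated_series (Suc N) [] [] x = (\<Prod>k=1..N. 1 - x\<^sup>2 / (of_nat k)\<^sup>2)" for N
    proof -
      have "truncated_series (Suc N) [] [] x = sine_factor 0 (Suc N) x"
        unfolding truncated_series_def append_Nil append_Nil2 by (rule sine_factor_series) simp
      also have "{0<..<Suc N} = {1..N}" by auto
      then have "sine_factor 0 (Suc N) x = (\<Prod>k=1..N. 1 - x\<^sup>2 / (of_nat k)\<^sup>2)"
        by (simp add: sine_factor_def)
      finally show ?thesis .
    qed
    ultimately have "mzv_series [] [] x = sin (pi * x) / (pi * x)"
      using sin_product_formula_real'[OF x(1)] by (simp add: LIMSEQ_unique)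
    moreover have "(\<lambda>a. (- (x\<^sup>2)) ^ a * sine_coeff a) sums (sin (pi * x) / (pi * x))"
    proof -
      have "(\<lambda>a. (- 1) ^ a / fact (2 * a + 1) * (pi * x) ^ (2 * a + 1)) sums sin (pi * x)"
        by (rule sin_paired)
      moreover have "(- 1) ^ a / fact (2 * a + 1) * (pi * x) ^ (2 * a + 1) / (pi * x) = (- (x\<^sup>2)) ^ a * sine_coeff a" for a
      proof -
        have 1: "(pi * x) ^ (2 * a + 1) / (pi * x) = pi ^ (2 * a) * x ^ (2 * a)"
          using x by (simp add: power_mult_distrib)
        have 2: "(- (x\<^sup>2)) ^ a = (- 1) ^ a * x ^ (2 * a)"
          by (simp add: power_minus[of "x\<^sup>2"] power_mult)
        have "(- 1) ^ a / fact (2 * a + 1) * (pi * x) ^ (2 * a + 1) / (pi * x) =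
            (- 1) ^ a / fact (2 * a + 1) * ((pi * x) ^ (2 * a + 1) / (pi * x))"
          by (rule times_divide_eq_right[symmetric])
        then show ?thesis unfolding 1 2 sine_coeff_def by simp
      qed
      ultimately show ?thesis using sums_divide[of _ _ "pi * x"] by fastforce
    qed
    moreover have "(\<lambda>a. (- (x\<^sup>2)) ^ a * mzv (replicate a 2)) sums mzv_series [] [] x"
      using summable_sums[OF summable[of "- (x\<^sup>2)"]] x by (simp add: mzv_series_def even_series_def)
    ultimately have "(\<lambda>a. (- (x\<^sup>2)) ^ a * c a) sums 0"
      using sums_diff by (fastforce simp: c_def right_diff_distrib)
    then show ?thesis by (simp add: even_series_def sums_iff)
  qed
  have sums: "(\<lambda>a. c a * (y - 0) ^ a) sums (\<Sum>a. y ^ a * c a)" if "norm (y - 0) < r" for y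
  proof -
    have "summable (\<lambda>a. y ^ a * c a)"
      using summable_diff[OF summable[of y] summable_sine_coeff[of y]] that
      by (simp add: c_def right_diff_distrib)
    then show ?thesis using summable_sums by (fastforce simp: mult.commute)
  qed
  show ?thesis
  proof (rule ccontr)
    assume "mzv (replicate a 2) \<noteq> sine_coeff a"
    then have "c a \<noteq> 0" by (simp add: c_def)
    have "c 0 = 0" by (simp add: c_def mzv_Nil sine_coeff_def)
    then have "a > 0" "(\<Sum>a. 0 ^ a * c a) = 0"
      using \<open>c a \<noteq> 0\<close> powser_zero[of c] by (auto simp: mult.commute intro: gr0I)
    then obtain s where s: "s > 0" "\<And>y. y \<in> cball 0 s - {0} \<Longrightarrow> (\<Sum>a. y ^ a * c a) \<noteq> 0"
      using powser_0_nonzero[OF r(1) sums _ \<open>c a \<noteq> 0\<close>] by metis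
    \<comment> \<open>Chosen so that \<open>y = - x^2\<close> is nonzero, inside the disc of
      convergence, and within the radius \<open>s\<close> where the series has no other
      zero.\<close>
    define x where "x = sqrt (min s r / 2)"
    have "x \<noteq> 0" "x\<^sup>2 < r" "x\<^sup>2 \<le> s" using s r by (auto simp: x_def min_def)
    then show False
      using zero[of x] s(2)[of "- (x\<^sup>2)"] by (simp add: even_series_def)
  qed
qed

text \<open>Gives every generating series the sine series as majorant, hence convergence everywhere
  and exponential type at most \<open>pi\<close>.\<close>

lemma mzv_insert_twos_le:
  assumes "admissible (u @ v)"
  shows "\<bar>mzv (u @ replicate a 2 @ v)\<bar> \<le> mzv (u @ v) * sine_coeff a"
  using mzv_insert_le[OF admissible_twos assms admissible_insert[OF assms], of a]
    mzv_nonneg[OF admissible_insert[OF assms], of a]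
  by (simp add: mzv_twos mult.commute)

lemma truncated_series_limit:
  assumes "admissible (u @ v)"
  shows "(\<lambda>N. truncated_series N u v x) \<longlonglongrightarrow> mzv_series u v x"
  using assms mzv_insert_twos_le[OF assms]
  by (intro truncated_series_tendsto summable_even_series)

text \<open>Uniformity in both cutoffs comes from majorising by the full sine series with all signs
  positive. It controls the error in the tail relation.\<close>

lemma sine_factor_bounded: "\<exists>B. \<forall>m N. \<bar>sine_factor m N x\<bar> \<le> B"
proof (intro exI allI)
  fix m N
  have "\<bar>sine_factor m N x\<bar> = \<bar>\<Sum>a\<le>N. (- (x\<^sup>2)) ^ a * between_sum (replicate a 2) m N\<bar>"
    by (simp add: sine_factor_series)
  also have "\<dots> \<le> (\<Sum>a\<le>N. \<bar>(- (x\<^sup>2)) ^ a * between_sum (replicate a 2) m N\<bar>)"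
    by (rule sum_abs)
  also have "\<dots> \<le> (\<Sum>a\<le>N. (x\<^sup>2) ^ a * sine_coeff a)"
  proof (rule sum_mono)
    fix a
    have "between_sum (replicate a 2) m N \<le> between_sum (replicate a 2) 0 N"
      by (rule between_sum_antimono) simp
    also have "\<dots> \<le> sine_coeff a"
      unfolding mzv_twos[symmetric] by (rule between_sum_tendsto_mzv(2)[OF admissible_twos])
    finally show "\<bar>(- (x\<^sup>2)) ^ a * between_sum (replicate a 2) m N\<bar> \<le> (x\<^sup>2) ^ a * sine_coeff a"
      by (auto simp: abs_mult power_abs between_sum_nonneg intro!: mult_left_mono)
  qed
  also have "\<dots> \<le> (\<Sum>a. (x\<^sup>2) ^ a * sine_coeff a)"
    by (intro sum_le_suminf summable_sine_coeff) (auto simp: sine_coeff_nonneg)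
  finally show "\<bar>sine_factor m N x\<bar> \<le> (\<Sum>a. (x\<^sup>2) ^ a * sine_coeff a)" .
qed

lemma mzv_series_head_contiguous:
  assumes "admissible v"
  shows "(x + 1)\<^sup>2 * mzv_series [] (3 # v) (x + 1) - x\<^sup>2 * mzv_series [] (3 # v) x =
    x * mzv_series [] (2 # v) x + (x + 1) * mzv_series [] (2 # v) (x + 1)"
proof -
  have "admissible ([] @ 3 # v)" "admissible ([] @ 2 # v)"
    using assms by (auto simp: admissible_def)
  note lim = truncated_series_limit[OF this(1)] truncated_series_limit[OF this(2)]
  have "(\<lambda>N. (x + 1)\<^sup>2 * truncated_series N [] (3 # v) (x + 1) - x\<^sup>2 * truncated_series N [] (3 # v) x)
      \<longlonglongrightarrow> (x + 1)\<^sup>2 * mzv_series [] (3 # v) (x + 1) - x\<^sup>2 * mzv_series [] (3 # v) x"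
    by (intro tendsto_intros lim)
  moreover have "(\<lambda>N. x * truncated_series N [] (2 # v) x + (x + 1) * truncated_series N [] (2 # v) (x + 1))
      \<longlonglongrightarrow> x * mzv_series [] (2 # v) x + (x + 1) * mzv_series [] (2 # v) (x + 1)"
    by (intro tendsto_intros lim)
  ultimately show ?thesis
    unfolding truncated_head_contiguous by (rule LIMSEQ_unique)
qed

lemma mzv_series_middle_contiguous:
  fixes x :: real
  assumes "admissible u" "admissible v"
  defines "y \<equiv> x + 1"
  shows "y\<^sup>2 * mzv_series (u @ [3]) (3 # v) y - x\<^sup>2 * mzv_series (u @ [3]) (3 # v) x =
    (x * mzv_series (u @ [3]) (2 # v) x + y * mzv_series (u @ [3]) (2 # v) y) -
    (x * mzv_series (u @ [2]) (3 # v) x + y * mzv_series (u @ [2]) (3 # v) y) +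
    (mzv_series (u @ [2]) (2 # v) y - mzv_series (u @ [2]) (2 # v) x)"
proof -
  have lim: "(\<lambda>N. truncated_series N (u @ [k]) (l # v) x) \<longlonglongrightarrow> mzv_series (u @ [k]) (l # v) x"
    if "k \<ge> 2" "l \<ge> 2" for k l x
    using assms that by (intro truncated_series_limit) (auto simp: admissible_def)
  have "(\<lambda>N. y\<^sup>2 * truncated_series N (u @ [3]) (3 # v) y - x\<^sup>2 * truncated_series N (u @ [3]) (3 # v) x)
      \<longlonglongrightarrow> y\<^sup>2 * mzv_series (u @ [3]) (3 # v) y - x\<^sup>2 * mzv_series (u @ [3]) (3 # v) x"
    by (intro tendsto_intros lim) auto
  moreover have "(\<lambda>N.
    (x * truncated_series N (u @ [3]) (2 # v) x + y * truncated_series N (u @ [3]) (2 # v) y) -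
    (x * truncated_series N (u @ [2]) (3 # v) x + y * truncated_series N (u @ [2]) (3 # v) y) +
    (truncated_series N (u @ [2]) (2 # v) y - truncated_series N (u @ [2]) (2 # v) x))
      \<longlonglongrightarrow>
    (x * mzv_series (u @ [3]) (2 # v) x + y * mzv_series (u @ [3]) (2 # v) y) -
    (x * mzv_series (u @ [2]) (3 # v) x + y * mzv_series (u @ [2]) (3 # v) y) +
    (mzv_series (u @ [2]) (2 # v) y - mzv_series (u @ [2]) (2 # v) x)"
    by (intro tendsto_intros lim) auto
  ultimately show ?thesis
    unfolding y_def truncated_middle_contiguous by (rule LIMSEQ_unique)
qed

text \<open>Each term \<open>(n / N) * b n\<close> tends to 0 for fixed \<open>n\<close> and is at
  most \<open>b n\<close> for \<open>n < N\<close>, so Tannery's theorem applies.\<close>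

lemma Kronecker_nonneg:
  fixes b :: "nat \<Rightarrow> real"
  assumes "summable b" "\<And>n. 0 \<le> b n"
  shows "(\<lambda>N. (\<Sum>n<N. real n * b n) / real N) \<longlonglongrightarrow> 0"
proof -
  define f where "f n N = (if n < N then real n * b n / real N else 0)" for n N
  have "(\<lambda>N. \<Sum>n. f n N) \<longlonglongrightarrow> (\<Sum>n. 0)"
  proof (rule tannerys_theorem[THEN conjunct2, THEN conjunct2])
    show "(f n \<longlongrightarrow> 0) sequentially" for n
    proof (rule Lim_transform_eventually)
      show "(\<lambda>N. real n * b n / real N) \<longlonglongrightarrow> 0" by (rule lim_const_over_n)
      show "\<forall>\<^sub>F N in sequentially. real n * b n / real N = f n N"
        using eventually_gt_at_top[of n] by eventually_elim (simp add: f_def)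
    qed
    have "norm (f n N) \<le> b n" for n N
      using assms(2)[of n] by (auto simp: f_def divide_le_eq mult.commute intro!: mult_right_mono)
    then show "\<forall>\<^sub>F (n, N) in sequentially \<times>\<^sub>F sequentially. norm (f n N) \<le> b n"
      by (intro always_eventually) auto
  qed (use assms in auto)
  moreover have "(\<Sum>n. f n N) = (\<Sum>n<N. real n * b n) / real N" for N
    by (subst suminf_finite[of "{..<N}"]) (auto simp: f_def sum_divide_distrib)
  ultimately show ?thesis by simp
qed

text \<open>Unlike the head and middle relations, this one fails at finite level: the cutoff
  \<open>N\<close> acts as the upper index of the sine factor and leaves an error. The error is at
  most a constant times the average in \<open>Kronecker_nonneg\<close> for the summands of
  \<open>zeta(u, 2)\<close>.\<close>

lemma mzv_series_tail_contiguous: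
  fixes x :: real
  assumes u: "\<forall>k\<in>set u. 1 \<le> k"
  defines "y \<equiv> x + 1"
  shows "y\<^sup>2 * mzv_series (u @ [1, 2]) [] y - x\<^sup>2 * mzv_series (u @ [1, 2]) [] x =
    x * mzv_series (u @ [2]) [] x + y * mzv_series (u @ [2]) [] y"
proof -
  define A where "A N = y\<^sup>2 * truncated_series N (u @ [1, 2]) [] y - x\<^sup>2 * truncated_series N (u @ [1, 2]) [] x" for N
  define B where "B N = x * truncated_series N (u @ [2]) [] x + y * truncated_series N (u @ [2]) [] y" for N
  define b where "b n = between_sum u 0 n / (real n)\<^sup>2" for n
  have adm: "admissible ((u @ [1, 2]) @ [])" "admissible ((u @ [2]) @ [])"
    using u by (auto simp: admissible_def)
  note lim = truncated_series_limit[OF adm(1)] truncated_series_limit[OF adm(2)]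
  have A: "A \<longlonglongrightarrow> y\<^sup>2 * mzv_series (u @ [1, 2]) [] y - x\<^sup>2 * mzv_series (u @ [1, 2]) [] x"
    unfolding A_def by (intro tendsto_intros lim)
  have B: "B \<longlonglongrightarrow> x * mzv_series (u @ [2]) [] x + y * mzv_series (u @ [2]) [] y"
    unfolding B_def by (intro tendsto_intros lim)
  have b_nonneg: "0 \<le> b n" for n by (simp add: b_def between_sum_nonneg)
  have "sum b {..<N} \<le> mzv (u @ [2])" for N
  proof -
    \<comment> \<open>The extra index 0 contributes nothing, since \<open>b 0 = 0\<close> by
      division by zero.\<close>
    have "sum b {..<N} = sum b {0<..<N}"
      by (rule sum.mono_neutral_right) (auto simp: b_def)
    also have "\<dots> = between_sum (u @ [2]) 0 N"
      by (simp add: between_sum_split b_def)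
    also have "\<dots> \<le> mzv (u @ [2])"
      using between_sum_tendsto_mzv(2)[OF adm(2)] by simp
    finally show ?thesis .
  qed
  then have "summable b"
    by (intro summableI_nonneg_bounded b_nonneg)
  obtain K1 K2 where K: "\<And>m N. \<bar>sine_factor m N x\<bar> \<le> K1" "\<And>m N. \<bar>sine_factor m N y\<bar> \<le> K2"
    using sine_factor_bounded by metis
  define K where "K = (\<bar>x\<bar> + x\<^sup>2) * K1 + (\<bar>y\<bar> + y\<^sup>2) * K2"
  \<comment> \<open>In this form \<open>e n N\<close> is visibly of order \<open>n\<close>,
    uniformly in \<open>N\<close>. By \<open>sine_factor_contiguous\<close> it is also
    \<open>N\<close> times the mismatch of the two sides at index \<open>n\<close>, up to the weight
    \<open>b n\<close>.\<close>
  define e where "e n N = real n * (x * sine_factor n N x + y * sine_factor n N y) +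
    (y\<^sup>2 * sine_factor n N y - x\<^sup>2 * sine_factor n N x)" for n N
  have e_bound: "\<bar>e n N\<bar> \<le> K * real n" if "n > 0" for n N
  proof -
    define p q where "p = sine_factor n N x" and "q = sine_factor n N y"
    have pq: "\<bar>p\<bar> \<le> K1" "\<bar>q\<bar> \<le> K2" by (simp_all add: p_def q_def K)
    have n: "1 \<le> real n" using that by simp
    have "\<bar>e n N\<bar> \<le> \<bar>real n * x * p\<bar> + \<bar>real n * y * q\<bar> + \<bar>y\<^sup>2 * q\<bar> + \<bar>x\<^sup>2 * p\<bar>"
      unfolding e_def p_def[symmetric] q_def[symmetric] by (simp add: distrib_left mult.assoc)
    also have "\<dots> = real n * (\<bar>x\<bar> * \<bar>p\<bar>) + real n * (\<bar>y\<bar> * \<bar>q\<bar>) + y\<^sup>2 * \<bar>q\<bar> + x\<^sup>2 * \<bar>p\<bar>"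
      by (simp add: abs_mult)
    also have "\<dots> \<le> real n * (\<bar>x\<bar> * K1) + real n * (\<bar>y\<bar> * K2) + real n * (y\<^sup>2 * K2) + real n * (x\<^sup>2 * K1)"
    proof -
      have "0 \<le> K1" "0 \<le> K2" using pq by linarith+
      have "x\<^sup>2 * \<bar>p\<bar> \<le> 1 * (x\<^sup>2 * K1)" "y\<^sup>2 * \<bar>q\<bar> \<le> 1 * (y\<^sup>2 * K2)"
        using pq by (auto intro: mult_left_mono)
      moreover have "1 * (x\<^sup>2 * K1) \<le> real n * (x\<^sup>2 * K1)" "1 * (y\<^sup>2 * K2) \<le> real n * (y\<^sup>2 * K2)"
        using n \<open>0 \<le> K1\<close> \<open>0 \<le> K2\<close> by (intro mult_right_mono; simp)+
      moreover have "real n * (\<bar>x\<bar> * \<bar>p\<bar>) \<le> real n * (\<bar>x\<bar> * K1)" "real n * (\<bar>y\<bar> * \<bar>q\<bar>) \<le> real n * (\<bar>y\<bar> * K2)"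
        using pq by (auto intro!: mult_left_mono)
      ultimately show ?thesis by linarith
    qed
    also have "\<dots> = K * real n" by (simp add: K_def algebra_simps)
    finally show ?thesis .
  qed
  have AB: "A N = B N - (\<Sum>n\<in>{0<..<N}. b n * e n N) / real N" for N
  proof -
    have "between_sum u 0 n * (1 / real n) * (1 - sine_factor n N y) -
        between_sum u 0 n * (1 / real n) * (1 - sine_factor n N x) =
        x * (between_sum u 0 n * (1 / real n ^ 2) * sine_factor n N x) +
        y * (between_sum u 0 n * (1 / real n ^ 2) * sine_factor n N y) - b n * e n N / real N"
      if "n \<in> {0<..<N}" for n
    proof -
      define p q c where "p = sine_factor n N x" and "q = sine_factor n N y" and "c = between_sum u 0 n"
      have n: "real n \<noteq> 0" "real N \<noteq> 0" using that by auto
      have "y\<^sup>2 * q - x\<^sup>2 * p = (real N - real n) * (x * p + y * q) + real N * real n * (q - p)"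
        using sine_factor_contiguous[of n N x] that by (simp add: p_def q_def y_def)
      then have "e n N = real N * ((x * p + y * q) - real n * (p - q))"
        unfolding e_def p_def[symmetric] q_def[symmetric] by (simp add: algebra_simps)
      then have be: "b n * e n N / real N = c / (real n)\<^sup>2 * ((x * p + y * q) - real n * (p - q))"
        using n by (simp add: b_def c_def)
      show ?thesis
        unfolding be p_def[symmetric] q_def[symmetric] c_def[symmetric]
        using n by (simp add: field_simps power2_eq_square)
    qed
    then show ?thesis
      unfolding A_def B_def truncated_series_tail_one_two truncated_series_tail sum_divide_distrib
        sum_distrib_left sum_subtractf[symmetric] sum.distrib[symmetric]
      by (intro sum.cong refl)
  qed
  have "(\<lambda>N. (\<Sum>n\<in>{0<..<N}. b n * e n N) / real N) \<longlonglongrightarrow> 0"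
  proof (rule Lim_null_comparison)
    show "(\<lambda>N. K * ((\<Sum>n<N. real n * b n) / real N)) \<longlonglongrightarrow> 0"
      using tendsto_mult[OF tendsto_const Kronecker_nonneg[OF \<open>summable b\<close> b_nonneg], of K] by simp
    have "norm ((\<Sum>n\<in>{0<..<N}. b n * e n N) / real N) \<le> K * ((\<Sum>n<N. real n * b n) / real N)" for N
    proof -
      have "\<bar>\<Sum>n\<in>{0<..<N}. b n * e n N\<bar> \<le> (\<Sum>n\<in>{0<..<N}. \<bar>b n * e n N\<bar>)"
        by (rule sum_abs)
      also have "\<dots> \<le> (\<Sum>n\<in>{0<..<N}. b n * (K * real n))"
        using e_bound b_nonneg by (intro sum_mono) (auto simp: abs_mult intro!: mult_left_mono)
      also have "\<dots> = (\<Sum>n<N. b n * (K * real n))"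
        by (rule sum.mono_neutral_left) auto
      also have "\<dots> = K * (\<Sum>n<N. real n * b n)"
        by (simp add: sum_distrib_left mult_ac)
      finally show ?thesis
        by (simp add: divide_right_mono)
    qed
    then show "\<forall>\<^sub>F N in sequentially. norm ((\<Sum>n\<in>{0<..<N}. b n * e n N) / real N) \<le>
        K * ((\<Sum>n<N. real n * b n) / real N)" by simp
  qed
  from tendsto_diff[OF B this] have "A \<longlonglongrightarrow> x * mzv_series (u @ [2]) [] x + y * mzv_series (u @ [2]) [] y"
    by (simp add: AB[abs_def])
  with A show ?thesis by (rule LIMSEQ_unique)
qed

subsection \<open>Duality and the cyclic relation\<close>

lemma even_series_diff:
  assumes "\<And>a. \<bar>c a\<bar> \<le> C * sine_coeff a" "\<And>a. \<bar>d a\<bar> \<le> D * sine_coeff a"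
  shows "even_series (\<lambda>a. c a - d a) x = even_series c x - even_series d x"
    and "\<bar>c a - d a\<bar> \<le> (C + D) * sine_coeff a"
proof -
  show "even_series (\<lambda>a. c a - d a) x = even_series c x - even_series d x"
    using suminf_diff[OF summable_even_series[OF assms(1), of "- (x\<^sup>2)"] summable_even_series[OF assms(2), of "- (x\<^sup>2)"]]
    by (simp add: even_series_def right_diff_distrib)
  show "\<bar>c a - d a\<bar> \<le> (C + D) * sine_coeff a"
    using assms(1)[of a] assms(2)[of a] by (simp add: distrib_right)
qed


text \<open>Both series satisfy the same inhomogeneous contiguity relation, so \<open>x\<^sup>2\<close> times their difference is periodic.\<close>
lemma mzv_eq_of_contiguous:
  assumes "admissible (u @ v)" "admissible (u' @ v')"
    and "\<And>x. (x + 1)\<^sup>2 * mzv_series u v (x + 1) - x\<^sup>2 * mzv_series u v x =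
      (x + 1)\<^sup>2 * mzv_series u' v' (x + 1) - x\<^sup>2 * mzv_series u' v' x"
  shows "mzv (u @ replicate a 2 @ v) = mzv (u' @ replicate a 2 @ v')"
proof -
  define c where "c a = mzv (u @ replicate a 2 @ v)" for a
  define d where "d a = mzv (u' @ replicate a 2 @ v')" for a
  have bounds: "\<bar>c a\<bar> \<le> mzv (u @ v) * sine_coeff a" "\<bar>d a\<bar> \<le> mzv (u' @ v') * sine_coeff a" for a
    unfolding c_def d_def by (intro mzv_insert_twos_le assms)+
  have "c a - d a = - 0"
  proof (rule periodic_even_series[where t = "\<lambda>_. 0" and T = 0])
    show "\<bar>c a - d a\<bar> \<le> (mzv (u @ v) + mzv (u' @ v')) * sine_coeff a" for a
      by (rule even_series_diff(2)[OF bounds])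
    show "(x + 1)\<^sup>2 * even_series (\<lambda>a. c a - d a) (x + 1) - even_series (\<lambda>_. 0) (x + 1) =
        x\<^sup>2 * even_series (\<lambda>a. c a - d a) x - even_series (\<lambda>_. 0) x" for x
      using assms(3)[of x]
      unfolding even_series_diff(1)[OF bounds] unfolding mzv_series_def c_def[abs_def] d_def[abs_def]
      by (simp add: even_series_def[of "\<lambda>_. 0"] algebra_simps)
  qed simp
  then show ?thesis by (simp add: c_def d_def)
qed

lemma replicate_two_Cons:
  fixes s :: "nat list"
  shows "replicate a 2 @ 2 # replicate b 2 @ s = replicate b 2 @ 2 # replicate a 2 @ s"
  by (simp add: replicate_app_Cons_same flip: replicate_Suc append_assoc replicate_add)

lemma mzv_series_eqI:
  assumes "\<And>a. mzv (u @ replicate a 2 @ v) = mzv (u' @ replicate a 2 @ v')"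
  shows "mzv_series u v = mzv_series u' v'"
  using assms by (simp add: mzv_series_def)

text \<open>As series in \<open>a\<close>, the two sides obey the head and the tail relation. The
  inhomogeneous terms agree because both are series of all-twos values.\<close>

lemma mzv_dual_three:
  "mzv (replicate a 2 @ 3 # replicate c 2) = mzv (replicate c 2 @ 1 # 2 # replicate a 2)"
proof -
  have "mzv ([] @ replicate a 2 @ 3 # replicate c 2) = mzv ((replicate c 2 @ [1, 2]) @ replicate a 2 @ [])"
  proof (rule mzv_eq_of_contiguous)
    have "mzv_series [] (2 # replicate c 2) = mzv_series (replicate c 2 @ [2]) []"
    proof (rule mzv_series_eqI)
      show "mzv ([] @ replicate a 2 @ 2 # replicate c 2) = mzv ((replicate c 2 @ [2]) @ replicate a 2 @ [])" for a
        using replicate_two_Cons[of a c "[]"] by simp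
    qed
    then show "(x + 1)\<^sup>2 * mzv_series [] (3 # replicate c 2) (x + 1) - x\<^sup>2 * mzv_series [] (3 # replicate c 2) x =
        (x + 1)\<^sup>2 * mzv_series (replicate c 2 @ [1, 2]) [] (x + 1) - x\<^sup>2 * mzv_series (replicate c 2 @ [1, 2]) [] x" for x
      by (subst mzv_series_head_contiguous mzv_series_tail_contiguous; simp add: admissible_twos)+
  qed (cases "c = 0"; auto simp: admissible_def)+
  then show ?thesis by simp
qed

text \<open>The same comparison one level up: lowering the first 3 merges two blocks of twos, and
  the inhomogeneous terms agree by \<open>mzv_dual_three\<close>.\<close>

lemma mzv_dual_three_three:
  "mzv (replicate a 2 @ 3 # replicate b 2 @ 3 # replicate c 2) =
    mzv (replicate c 2 @ 1 # 2 # replicate b 2 @ 1 # 2 # replicate a 2)"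
proof -
  define v where "v = replicate b (2 :: nat) @ 3 # replicate c 2"
  define u where "u = replicate c (2 :: nat) @ [1, 2] @ replicate b 2"
  have v: "admissible v" by (cases "c = 0") (auto simp: v_def admissible_def)
  have u: "\<forall>k\<in>set u. 1 \<le> k" by (auto simp: u_def)
  have "mzv ([] @ replicate a 2 @ 3 # v) = mzv ((u @ [1, 2]) @ replicate a 2 @ [])"
  proof (rule mzv_eq_of_contiguous)
    have "mzv_series [] (2 # v) = mzv_series (u @ [2]) []"
    proof (rule mzv_series_eqI)
      fix a
      have "mzv ([] @ replicate a 2 @ 2 # v) = mzv (replicate (a + 1 + b) 2 @ 3 # replicate c 2)"
        by (simp add: v_def replicate_add replicate_app_Cons_same)
      also have "\<dots> = mzv (replicate c 2 @ 1 # 2 # replicate (b + 1 + a) 2)"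
        using mzv_dual_three[of "a + 1 + b" c] by (simp add: add_ac)
      also have "\<dots> = mzv ((u @ [2]) @ replicate a 2 @ [])"
        by (simp add: u_def replicate_add replicate_app_Cons_same)
      finally show "mzv ([] @ replicate a 2 @ 2 # v) = mzv ((u @ [2]) @ replicate a 2 @ [])" .
    qed
    then show "(x + 1)\<^sup>2 * mzv_series [] (3 # v) (x + 1) - x\<^sup>2 * mzv_series [] (3 # v) x =
        (x + 1)\<^sup>2 * mzv_series (u @ [1, 2]) [] (x + 1) - x\<^sup>2 * mzv_series (u @ [1, 2]) [] x" for x
      unfolding mzv_series_head_contiguous[OF v] mzv_series_tail_contiguous[OF u] by simp
  qed (use u v in \<open>auto simp: admissible_def\<close>)
  then show ?thesis by (simp add: u_def v_def)
qed

text \<open>Adding the head and middle relations and subtracting the tail relation, all in the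
  variable \<open>a\<close>, cancels every bracket. Only the difference of the series
  \<open>t\<close> survives, and its coefficients are all-twos values.\<close>

lemma mzv_cyclic_three:
  "mzv (replicate a 2 @ 3 # replicate b 2 @ 3 # replicate c 2) +
   mzv (replicate b 2 @ 3 # replicate a 2 @ 3 # replicate c 2) -
   mzv (replicate b 2 @ 3 # replicate c 2 @ 1 # 2 # replicate a 2) = - sine_coeff (a + b + c + 3)"
proof -
  define u where "u = replicate b (2 :: nat)"
  define v where "v = replicate c (2 :: nat)"
  have u: "admissible u" and v: "admissible v" by (simp_all add: u_def v_def admissible_twos)
  have pos: "\<forall>k\<in>set u. 1 \<le> k" "\<forall>k\<in>set v. 1 \<le> k" by (auto simp: u_def v_def)
  define c1 where "c1 a = mzv ([] @ replicate a 2 @ 3 # u @ 3 # v)" for a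
  define c2 where "c2 a = mzv ((u @ [3]) @ replicate a 2 @ 3 # v)" for a
  define c3 where "c3 a = mzv ((u @ 3 # v @ [1, 2]) @ replicate a 2 @ [])" for a
  define t where "t a = mzv ((u @ [2]) @ replicate a 2 @ 2 # v)" for a
  have adm: "admissible ([] @ 3 # u @ 3 # v)" "admissible ((u @ [3]) @ 3 # v)"
    "admissible ((u @ 3 # v @ [1, 2]) @ [])" "admissible ((u @ [2]) @ 2 # v)" "admissible (u @ 3 # v)"
    using u v by (auto simp: admissible_def)
  note b1 = mzv_insert_twos_le[OF adm(1), folded c1_def]
  note b2 = mzv_insert_twos_le[OF adm(2), folded c2_def]
  note b3 = mzv_insert_twos_le[OF adm(3), folded c3_def]
  note bt = mzv_insert_twos_le[OF adm(4), folded t_def]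
  note b32 = even_series_diff(2)[OF b3 b2]
  have "c1 a - (c3 a - c2 a) = - t (Suc a)"
  proof (rule periodic_even_series[OF even_series_diff(2)[OF b1 b32] bt])
    fix x :: real
    \<comment> \<open>The varying block commutes past \<open>2 # u\<close>, so the head bracket is
      the one that the middle relation subtracts; \<open>tail\<close> matches the other bracket
      likewise.\<close>
    have head: "mzv_series [] (2 # u @ 3 # v) = mzv_series (u @ [2]) (3 # v)"
    proof (rule mzv_series_eqI)
      show "mzv ([] @ replicate a 2 @ 2 # u @ 3 # v) = mzv ((u @ [2]) @ replicate a 2 @ 3 # v)" for a
        by (simp add: u_def replicate_two_Cons[of a b "3 # v"])
    qed
    have tail: "mzv_series ((u @ 3 # v) @ [2]) [] = mzv_series (u @ [3]) (2 # v)"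
    proof (rule mzv_series_eqI)
      show "mzv (((u @ 3 # v) @ [2]) @ replicate a 2 @ []) = mzv ((u @ [3]) @ replicate a 2 @ 2 # v)" for a
        using replicate_two_Cons[of c a "[]"] by (simp add: v_def)
    qed
    have "(x + 1)\<^sup>2 * mzv_series [] (3 # u @ 3 # v) (x + 1) - x\<^sup>2 * mzv_series [] (3 # u @ 3 # v) x =
        x * mzv_series (u @ [2]) (3 # v) x + (x + 1) * mzv_series (u @ [2]) (3 # v) (x + 1)"
      using mzv_series_head_contiguous[OF adm(5), of x] unfolding head .
    moreover have "(x + 1)\<^sup>2 * mzv_series (u @ 3 # v @ [1, 2]) [] (x + 1) - x\<^sup>2 * mzv_series (u @ 3 # v @ [1, 2]) [] x =
        x * mzv_series (u @ [3]) (2 # v) x + (x + 1) * mzv_series (u @ [3]) (2 # v) (x + 1)"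
    proof -
      have "\<forall>k\<in>set (u @ 3 # v). 1 \<le> k" using pos by auto
      from mzv_series_tail_contiguous[OF this, of x] show ?thesis unfolding tail by simp
    qed
    moreover note mzv_series_middle_contiguous[OF u v, of x]
    moreover have combined: "even_series (\<lambda>a. c1 a - (c3 a - c2 a)) x = mzv_series [] (3 # u @ 3 # v) x -
        (mzv_series (u @ 3 # v @ [1, 2]) [] x - mzv_series (u @ [3]) (3 # v) x)"
      "even_series t x = mzv_series (u @ [2]) (2 # v) x" for x
      unfolding even_series_diff(1)[OF b1 b32] even_series_diff(1)[OF b3 b2]
      by (simp_all add: mzv_series_def c1_def[abs_def] c2_def[abs_def] c3_def[abs_def] t_def[abs_def])
    ultimately show "(x + 1)\<^sup>2 * even_series (\<lambda>a. c1 a - (c3 a - c2 a)) (x + 1) - even_series t (x + 1) =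
        x\<^sup>2 * even_series (\<lambda>a. c1 a - (c3 a - c2 a)) x - even_series t x"
      unfolding combined right_diff_distrib by linarith
  qed
  moreover have "t (Suc a) = sine_coeff (a + b + c + 3)"
  proof -
    have "(u @ [2]) @ replicate (Suc a) 2 @ 2 # v = replicate (b + 1 + Suc a + 1 + c) 2"
      unfolding replicate_add u_def v_def by simp
    then have "t (Suc a) = mzv (replicate (b + 1 + Suc a + 1 + c) 2)" by (simp only: t_def)
    then show ?thesis by (simp only: mzv_twos) (simp add: add_ac numeral_3_eq_3)
  qed
  ultimately show ?thesis by (simp add: c1_def c2_def c3_def u_def v_def)
qed

theorem theorem7p13:
  "(\<forall>b1 b2 b3 :: nat. let w = 2 * (b1 + b2 + b3) + 6 in
      \<exists>q :: rat. mzv_bar [Three, Three] [b1, b2, b3]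
                  - mzv_bar [Three, OneTwo] [b2, b3, b1]
                  + mzv_bar [OneTwo, OneTwo] [b3, b1, b2]
                = of_rat q * (pi ^ w / fact (w + 1))) \<and>
   (\<forall>m :: nat. \<exists>q :: rat.
      2 * mzv ([3, 3] @ replicate m 2) - mzv ([3] @ replicate m 2 @ [1, 2])
        = of_rat q * pi ^ (2 * m + 6))"
proof (intro conjI allI)
  fix b1 b2 b3 :: nat
  define w where "w = 2 * (b1 + b2 + b3) + 6"
  have "mzv_bar [Three, Three] [b1, b2, b3] - mzv_bar [Three, OneTwo] [b2, b3, b1] +
      mzv_bar [OneTwo, OneTwo] [b3, b1, b2] = - sine_coeff (b1 + b2 + b3 + 3)"
    \<comment> \<open>Duality turns the second summand of the cyclic relation, with blocks
      \<open>b2, b1, b3\<close>, into the value with two pairs \<open>1, 2\<close> and blocks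
      \<open>b3, b1, b2\<close>.\<close>
    using mzv_cyclic_three[of b1 b2 b3] mzv_dual_three_three[of b2 b1 b3]
    by (simp add: mzv_bar_def)
  also have "\<dots> = of_rat (- 1) * (pi ^ w / fact (w + 1))"
  proof -
    have "2 * (b1 + b2 + b3 + 3) = w" by (simp add: w_def)
    then show ?thesis by (simp add: sine_coeff_def of_rat_minus del: fact_Suc)
  qed
  finally show "let w = 2 * (b1 + b2 + b3) + 6 in
      \<exists>q :: rat. mzv_bar [Three, Three] [b1, b2, b3]
                  - mzv_bar [Three, OneTwo] [b2, b3, b1]
                  + mzv_bar [OneTwo, OneTwo] [b3, b1, b2]
                = of_rat q * (pi ^ w / fact (w + 1))"
    unfolding Let_def w_def by blast
next
  fix m :: nat
  have "2 * mzv ([3, 3] @ replicate m 2) - mzv ([3] @ replicate m 2 @ [1, 2]) = - sine_coeff (m + 3)"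
    \<comment> \<open>With the first two blocks empty, the two values with two 3s coincide, whence
      the factor 2.\<close>
    using mzv_cyclic_three[of 0 0 m] by simp
  also have "\<dots> = of_rat (- 1 / fact (2 * m + 7)) * pi ^ (2 * m + 6)"
  proof -
    have "real_of_rat (fact n) = fact n" for n
      using of_rat_of_nat_eq[of "fact n", where 'a = real] by (simp only: of_nat_fact)
    moreover have "sine_coeff (m + 3) = pi ^ (2 * m + 6) / fact (2 * m + 7)"
      by (simp add: sine_coeff_def add_ac del: fact_Suc)
    ultimately show ?thesis by (simp add: of_rat_minus of_rat_divide del: fact_Suc)
  qed
  finally show "\<exists>q :: rat. 2 * mzv ([3, 3] @ replicate m 2) - mzv ([3] @ replicate m 2 @ [1, 2])
        = of_rat q * pi ^ (2 * m + 6)" by blast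
qed

end
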